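(* Let $(\mathcal{B},\|\cdot\|_{\mathcal{B}})$ be a separable Banach space, $k\in\mathbb{N}$, and let $C\subset\mathcal{B}$ contain at least $k$ points. Let $X$ be a random element of $\mathcal{B}$ with distribution $\mathrm{P}$. Assume that $\mathrm{E}\|X\|_{\mathcal{B}}^2<\infty$, that $C$ is bounded in $\mathcal{B}$, and that the class $\mathcal{F}_{V_k(C)}$ is $\mathrm{P}$-Donsker. Let $T(k)=\inf_{f\in S_{\mathrm{P}}(k,C)}\mathbb{G}_{\mathrm{P}}(f)$. The following three assertions are equivalent: (i) $\mathrm{P}\in\mathrm{UP}(k,C)$ (uniqueness of $k$-means on $C$), that is, the set $S_{\mathrm{P}}(k,C)$ has cardinality one. (ii) The variable $T(k)$ is normally distributed with mean zero. (iii) The variable $T(k)$ has zero mean.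
   Context: $\mathrm{P}(f)$ denotes $\mathrm{E}_{\mathrm{P}}(f)$. $V_k(C)=\{(a_1,\dots,a_k)\in C^k: a_i\ne a_j\text{ for }i\ne j\}$. For $a=(a_1,\dots,a_k)\in V_k(C)$, $f_a:\mathcal{B}\to\mathbb{R}$ is $f_a(z)=\min_{i=1,\dots,k}\|z-a_i\|_{\mathcal{B}}^2$. $\mathcal{F}_{V_k(C)}=\{f_a:a\in V_k(C)\}$, and $W(k,C)=\inf_{f\in\mathcal{F}_{V_k(C)}}\mathrm{P}(f)$. For a class $\mathcal{F}$ of real functions, $\ell^\infty(\mathcal{F})$ is the Banach space of bounded functionals on $\mathcal{F}$ with the supremum norm. With $X_1,X_2,\dots$ independent observations of $X$, the empirical process is $\mathbb{G}_n(f)=n^{-1/2}\sum_{i=1}^n(f(X_i)-\mathrm{P}(f))$, $f\in\mathcal{F}$. $\mathcal{F}$ is $\mathrm{P}$-Donsker if $\mathbb{G}_n\rightsquigarrow\mathbb{G}_{\mathrm{P}}$ in $\ell^\infty(\mathcal{F})$ (weak convergence in the sense of empirical process theory, with outer expectations), where $\mathbb{G}_{\mathrm{P}}$ is a $\mathrm{P}$-Brownian bridge indexed by $\mathcal{F}$: a (tight) zero-mean Gaussian process with covariance $\mathrm{Cov}(\mathbb{G}_{\mathrm{P}}(f_1),\mathbb{G}_{\mathrm{P}}(f_2))=\mathrm{P}(f_1f_2)-\mathrm{P}(f_1)\mathrm{P}(f_2)$. $\overline{\mathcal{F}}_{V_k(C)}$ is the completion of $\mathcal{F}_{V_k(C)}$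 with respect to the metric $d_{\mathrm{L}^2(\mathrm{P})}^2(f,g)=\mathrm{P}(f-g)^2$; functions equal $\mathrm{P}$-almost everywhere are identified. $\mathrm{P}$ and $\mathbb{G}_{\mathrm{P}}$ (taken with sample paths uniformly continuous with respect to $d_{\mathrm{L}^2(\mathrm{P})}$) are extended by continuity to $\overline{\mathcal{F}}_{V_k(C)}$, and $S_{\mathrm{P}}(k,C)=\{f\in\overline{\mathcal{F}}_{V_k(C)}:\mathrm{P}(f)=W(k,C)\}$. The constant $0$ is regarded as a (degenerate) normal variable with mean zero. *)

theory Defs
  imports "HOL-Probability.Probability"
begin

section \<open>Normal variables and Gaussian processes\<close>

text \<open>Degenerate (almost surely constant) variables count as normal.\<close>

definition normal_rv :: "'w measure \<Rightarrow> ('w \<Rightarrow> real) \<Rightarrow> real \<Rightarrow> bool" where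
  "normal_rv N Y \<mu> \<longleftrightarrow> Y \<in> borel_measurable N \<and>
     ((\<exists>\<sigma>>0. distributed N lborel Y (\<lambda>x. ennreal (normal_density \<mu> \<sigma> x))) \<or> (AE \<omega> in N. Y \<omega> = \<mu>))"

definition zero_mean :: "'w measure \<Rightarrow> ('w \<Rightarrow> real) \<Rightarrow> bool" where
  "zero_mean N Y \<longleftrightarrow> integrable N Y \<and> (\<integral>\<omega>. Y \<omega> \<partial>N) = 0"

definition gaussian_process :: "'w measure \<Rightarrow> 'i set \<Rightarrow> ('w \<Rightarrow> 'i \<Rightarrow> real) \<Rightarrow> bool" where
  "gaussian_process N I G \<longleftrightarrow>
     (\<forall>J c. finite J \<and> J \<subseteq> I \<longrightarrow> (\<exists>\<mu>. normal_rv N (\<lambda>\<omega>. \<Sum>i\<in>J. c i * G \<omega> i) \<mu>))"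

section \<open>Weak convergence with outer expectations\<close>

definition borel_of_metric :: "'s metric \<Rightarrow> 's measure" where
  "borel_of_metric D = sigma (mspace D) {U. openin (mtopology_of D) U}"

text \<open>Only used for bounded \<open>Y\<close>, so that the infimum is over a nonempty set bounded below.\<close>

definition outer_expectation :: "'a measure \<Rightarrow> ('a \<Rightarrow> real) \<Rightarrow> real" where
  "outer_expectation M Y =
     Inf {(\<integral>\<omega>. U \<omega> \<partial>M) |U. integrable M U \<and> (\<forall>\<omega>\<in>space M. Y \<omega> \<le> U \<omega>)}"

text \<open>The maps \<open>Y n\<close> need not be measurable; the limit \<open>Z\<close> has to be.\<close>

definition weakly_converges ::
  "'s metric \<Rightarrow> 'a measure \<Rightarrow> (nat \<Rightarrow> 'a \<Rightarrow> 's) \<Rightarrow> 'w measure \<Rightarrow> ('w \<Rightarrow> 's) \<Rightarrow> bool" where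
  "weakly_converges D M Y N Z \<longleftrightarrow>
     (\<forall>n. \<forall>\<omega>\<in>space M. Y n \<omega> \<in> mspace D) \<and>
     Z \<in> N \<rightarrow>\<^sub>M borel_of_metric D \<and>
     (\<forall>h. continuous_map (mtopology_of D) euclideanreal h \<and> bounded (h ` mspace D) \<longrightarrow>
        (\<lambda>n. outer_expectation M (\<lambda>\<omega>. h (Y n \<omega>))) \<longlonglongrightarrow> (\<integral>\<omega>. h (Z \<omega>) \<partial>N))"

definition tight_rv :: "'s metric \<Rightarrow> 'w measure \<Rightarrow> ('w \<Rightarrow> 's) \<Rightarrow> bool" where
  "tight_rv D N Z \<longleftrightarrow>
     (\<forall>\<epsilon>>0. \<exists>K. compactin (mtopology_of D) K \<and> measure N {\<omega>\<in>space N. Z \<omega> \<in> K} \<ge> 1 - \<epsilon>)"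

section \<open>Empirical processes and Donsker classes\<close>

text \<open>Bounded functionals on \<open>F\<close> with the supremum distance; outside \<open>F\<close> they are \<open>undefined\<close>.\<close>

abbreviation linfty :: "'f set \<Rightarrow> ('f \<Rightarrow> real) metric" where
  "linfty F \<equiv> funspace F euclidean_metric"

definition L2_funs :: "'b measure \<Rightarrow> ('b \<Rightarrow> real) set" where
  "L2_funs P = {f \<in> borel_measurable P. integrable P (\<lambda>z. (f z)\<^sup>2)}"

definition L2_dist :: "'b measure \<Rightarrow> ('b \<Rightarrow> real) \<Rightarrow> ('b \<Rightarrow> real) \<Rightarrow> real" where
  "L2_dist P f g = sqrt (\<integral>z. (f z - g z)\<^sup>2 \<partial>P)"

definition empirical_process ::
  "'b measure \<Rightarrow> ('b \<Rightarrow> real) set \<Rightarrow> nat \<Rightarrow> (nat \<Rightarrow> 'b) \<Rightarrow> ('b \<Rightarrow> real) \<Rightarrow> real" where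
  "empirical_process P F n x = (\<lambda>f\<in>F. (\<Sum>i<n. (f (x i) - (\<integral>z. f z \<partial>P))) / sqrt (real n))"

text \<open>The inclusion in \<open>L2_funs P\<close> is what makes the covariance formula meaningful.\<close>

definition brownian_bridge ::
  "'b measure \<Rightarrow> ('b \<Rightarrow> real) set \<Rightarrow> 'w measure \<Rightarrow> ('w \<Rightarrow> ('b \<Rightarrow> real) \<Rightarrow> real) \<Rightarrow> bool" where
  "brownian_bridge P F N G \<longleftrightarrow>
     F \<subseteq> L2_funs P \<and>
     prob_space N \<and>
     G \<in> N \<rightarrow>\<^sub>M borel_of_metric (linfty F) \<and>
     tight_rv (linfty F) N G \<and>
     gaussian_process N F G \<and>
     (\<forall>f\<in>F. zero_mean N (\<lambda>\<omega>. G \<omega> f)) \<and>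
     (\<forall>f\<in>F. \<forall>g\<in>F. (\<integral>\<omega>. G \<omega> f * G \<omega> g \<partial>N) =
        (\<integral>z. f z * g z \<partial>P) - (\<integral>z. f z \<partial>P) * (\<integral>z. g z \<partial>P))"

text \<open>The observations are the coordinate projections of the product space \<open>P\<^sup>\<infinity>\<close>. The limit is
  realised on \<open>linfty F\<close> itself; only its law matters.\<close>

definition donsker :: "'b measure \<Rightarrow> ('b \<Rightarrow> real) set \<Rightarrow> bool" where
  "donsker P F \<longleftrightarrow>
     (\<exists>L :: (('b \<Rightarrow> real) \<Rightarrow> real) measure.
        brownian_bridge P F L (\<lambda>u. u) \<and>
        weakly_converges (linfty F) (\<Pi>\<^sub>M i\<in>(UNIV::nat set). P) (empirical_process P F) L (\<lambda>u. u))"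

section \<open>\<open>L\<^sup>2\<close>-completion of a class and extension by continuity\<close>

text \<open>For \<open>F \<subseteq> L2_funs P\<close>, as holds for Donsker classes, the completion is realised as the closure
  of \<open>F\<close> in the complete space \<open>L\<^sup>2(P)\<close>. Its elements are classes of almost everywhere equal
  functions.\<close>

definition ae_eq_rel :: "'b measure \<Rightarrow> (('b \<Rightarrow> real) \<times> ('b \<Rightarrow> real)) set" where
  "ae_eq_rel P = {(f, g). f \<in> L2_funs P \<and> g \<in> L2_funs P \<and> (AE z in P. f z = g z)}"

definition L2_completion :: "'b measure \<Rightarrow> ('b \<Rightarrow> real) set \<Rightarrow> ('b \<Rightarrow> real) set set" where
  "L2_completion P F = {g \<in> L2_funs P. \<forall>\<epsilon>>0. \<exists>f\<in>F. L2_dist P f g < \<epsilon>} // ae_eq_rel P"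

text \<open>The value at the class \<open>q\<close> is the limit of \<open>u f\<close> as \<open>f \<in> F\<close> approaches \<open>q\<close>.\<close>

definition extend_cont ::
  "'b measure \<Rightarrow> ('b \<Rightarrow> real) set \<Rightarrow> (('b \<Rightarrow> real) \<Rightarrow> real) \<Rightarrow> ('b \<Rightarrow> real) set \<Rightarrow> real" where
  "extend_cont P F u q =
     Lim (INF \<delta>\<in>{0<..}. principal {f \<in> F. \<forall>g\<in>q. L2_dist P f g < \<delta>}) u"

definition L2_uniformly_continuous ::
  "'b measure \<Rightarrow> ('b \<Rightarrow> real) set \<Rightarrow> (('b \<Rightarrow> real) \<Rightarrow> real) \<Rightarrow> bool" where
  "L2_uniformly_continuous P F u \<longleftrightarrow>
     (\<forall>\<epsilon>>0. \<exists>\<delta>>0. \<forall>f\<in>F. \<forall>g\<in>F. L2_dist P f g < \<delta> \<longrightarrow> \<bar>u f - u g\<bar> < \<epsilon>)"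

section \<open>The \<open>k\<close>-means functionals\<close>

definition distinct_tuples :: "nat \<Rightarrow> 'b set \<Rightarrow> 'b list set" where
  "distinct_tuples k C = {a. length a = k \<and> distinct a \<and> set a \<subseteq> C}"

definition kmeans_fun :: "'b::real_normed_vector list \<Rightarrow> 'b \<Rightarrow> real" where
  "kmeans_fun a z = (MIN c\<in>set a. (norm (z - c))\<^sup>2)"

definition kmeans_class :: "nat \<Rightarrow> 'b::real_normed_vector set \<Rightarrow> ('b \<Rightarrow> real) set" where
  "kmeans_class k C = kmeans_fun ` distinct_tuples k C"

definition kmeans_opt :: "'b::real_normed_vector measure \<Rightarrow> nat \<Rightarrow> 'b set \<Rightarrow> real" where
  "kmeans_opt P k C = (INF f\<in>kmeans_class k C. \<integral>z. f z \<partial>P)"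

definition kmeans_argmin ::
  "'b::real_normed_vector measure \<Rightarrow> nat \<Rightarrow> 'b set \<Rightarrow> ('b \<Rightarrow> real) set set" where
  "kmeans_argmin P k C =
     {q \<in> L2_completion P (kmeans_class k C).
        extend_cont P (kmeans_class k C) (\<lambda>f. \<integral>z. f z \<partial>P) q = kmeans_opt P k C}"

definition kmeans_unique :: "'b::real_normed_vector measure \<Rightarrow> nat \<Rightarrow> 'b set \<Rightarrow> bool" where
  "kmeans_unique P k C \<longleftrightarrow> card (kmeans_argmin P k C) = 1"

definition kmeans_limit ::
  "'b::real_normed_vector measure \<Rightarrow> nat \<Rightarrow> 'b set \<Rightarrow> (('b \<Rightarrow> real) \<Rightarrow> real) \<Rightarrow> real" where
  "kmeans_limit P k C u = (INF q\<in>kmeans_argmin P k C. extend_cont P (kmeans_class k C) u q)"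

end

theory Submission
  imports Defs "HOL-Complex_Analysis.Great_Picard"
begin

text \<open>
  A \<open>q\<close> in the closure of the class is an \<open>L\<^sup>2\<close>-limit of \<open>f\<^sub>n\<close> in the class, so the extended process at \<open>q\<close> is
  a pointwise limit of centred normal variables and therefore centred normal. If the minimiser is
  unique, \<open>T\<close> is one such variable. Conversely, \<open>T\<close> lies below the process at each minimiser; if
  \<open>T\<close> has mean zero, it agrees almost surely with the process at every minimiser. Two minimisers
  \<open>q\<close>, \<open>q'\<close> then satisfy \<open>Var(q - q') = 0\<close> and have the same mean, so \<open>q = q'\<close>. A minimiser exists
  because tightness of the Brownian bridge makes the class relatively compact in \<open>L\<^sup>2(P)\<close>: the paths
  in a compact set of probability at least \<open>1 / 2\<close> oscillate uniformly little along a subsequence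
  of a minimising sequence, and a centred normal variable that is small with probability at least
  \<open>1 / 2\<close> has small variance.
\<close>

section \<open>Centred normal variables\<close>

lemma normal_rv_expectation:
  assumes "prob_space N" "normal_rv N Y \<mu>"
  shows "integrable N Y" "(\<integral>\<omega>. Y \<omega> \<partial>N) = \<mu>"
proof -
  interpret prob_space N by fact
  have m[measurable]: "Y \<in> borel_measurable N"
    using assms(2) by (simp add: normal_rv_def)
  have "integrable N Y \<and> (\<integral>\<omega>. Y \<omega> \<partial>N) = \<mu>"
  proof (cases "AE \<omega> in N. Y \<omega> = \<mu>")
    case True
    then have "integrable N Y \<longleftrightarrow> integrable N (\<lambda>_. \<mu>)"
      by (intro integrable_cong_AE) auto
    moreover have "(\<integral>\<omega>. Y \<omega> \<partial>N) = (\<integral>\<omega>. \<mu> \<partial>N)"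
      using True by (intro integral_cong_AE) auto
    ultimately show ?thesis by (simp add: prob_space)
  next
    case False
    then obtain \<sigma> where \<sigma>: "\<sigma> > 0" and D: "distributed N lborel Y (normal_density \<mu> \<sigma>)"
      using assms(2) by (auto simp: normal_rv_def)
    then show ?thesis
      using normal_distributed_expectation[OF \<sigma> D]
        distributed_integrable_var[OF D] integrable_normal_moment_nz_1[OF \<sigma>]
      by auto
  qed
  then show "integrable N Y" "(\<integral>\<omega>. Y \<omega> \<partial>N) = \<mu>" by auto
qed

lemma normal_rv_integrable_square:
  assumes "prob_space N" "normal_rv N Y \<mu>"
  shows "integrable N (\<lambda>\<omega>. (Y \<omega>)\<^sup>2)"
proof -
  interpret prob_space N by fact
  have m[measurable]: "Y \<in> borel_measurable N"
    using assms(2) by (simp add: normal_rv_def)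
  show ?thesis
  proof (cases "AE \<omega> in N. Y \<omega> = \<mu>")
    case True
    then have "integrable N (\<lambda>\<omega>. (Y \<omega>)\<^sup>2) \<longleftrightarrow> integrable N (\<lambda>_. \<mu>\<^sup>2)"
      by (intro integrable_cong_AE) auto
    then show ?thesis by simp
  next
    case False
    then obtain \<sigma> where \<sigma>: "\<sigma> > 0" and D: "distributed N lborel Y (normal_density \<mu> \<sigma>)"
      using assms(2) by (auto simp: normal_rv_def)
    have "integrable N (\<lambda>\<omega>. (Y \<omega> - \<mu>)\<^sup>2)"
      using distributed_integrable[OF D, of "\<lambda>x. (x - \<mu>)\<^sup>2"] integrable_normal_moment[OF \<sigma>, of \<mu> 2]
      by simp
    then have "integrable N (\<lambda>\<omega>. (Y \<omega> - \<mu>)\<^sup>2 + 2 * \<mu> * Y \<omega> - \<mu>\<^sup>2)"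
      using normal_rv_expectation(1)[OF assms] by auto
    then show ?thesis
      by (simp add: power2_eq_square algebra_simps)
  qed
qed

lemma normal_distributed_second_moment:
  assumes "prob_space N" "0 < \<sigma>" "distributed N lborel Y (normal_density 0 \<sigma>)"
  shows "(\<integral>\<omega>. (Y \<omega>)\<^sup>2 \<partial>N) = \<sigma>\<^sup>2"
proof -
  interpret prob_space N by fact
  show ?thesis
    using normal_distributed_variance[OF assms(2,3)] normal_distributed_expectation[OF assms(2,3)]
    by simp
qed

lemma char_normal_distributed:
  assumes "prob_space N" "0 < \<sigma>" "distributed N lborel Y (normal_density 0 \<sigma>)"
  shows "char (distr N borel Y) t = exp (- (\<sigma>\<^sup>2 * t\<^sup>2) / 2)"
proof -
  interpret prob_space N by fact
  have [measurable]: "Y \<in> borel_measurable N"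
    using distributed_measurable[OF assms(3)] by simp
  have "distributed N lborel (\<lambda>\<omega>. (Y \<omega> - 0) / \<sigma>) std_normal_density"
    using normal_standard_normal_convert[OF assms(2), of Y 0] assms(3) by simp
  then have "distr N borel (\<lambda>\<omega>. Y \<omega> / \<sigma>) = std_normal_distribution"
    by (subst distributed_distr_eq_density[symmetric, where N = lborel and X = "\<lambda>\<omega>. Y \<omega> / \<sigma>"])
      (auto intro!: distr_cong)
  \<comment> \<open>The argument is scaled because the characteristic function of
    \<open>Y / \<sigma>\<close> at \<open>t * \<sigma>\<close> is that of \<open>Y\<close> at
    \<open>t\<close>.\<close>
  then have "char (distr N borel (\<lambda>\<omega>. Y \<omega> / \<sigma>)) (t * \<sigma>) = exp (- ((t * \<sigma>)\<^sup>2) / 2)"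
    by (simp add: char_std_normal_distribution)
  then show ?thesis
    using assms(2) by (simp add: char_def integral_distr power_mult_distrib mult.commute)
qed

text \<open>The exponent contains the second moment instead of a parameter \<sigma>, so one formula
  covers degenerate and nondegenerate variables and can be passed to a limit in which the variance
  may vanish.\<close>

lemma char_normal_rv:
  assumes "prob_space N" "normal_rv N Y 0"
  shows "char (distr N borel Y) t = exp (- ((\<integral>\<omega>. (Y \<omega>)\<^sup>2 \<partial>N) * t\<^sup>2) / 2)"
proof -
  interpret prob_space N by fact
  have m[measurable]: "Y \<in> borel_measurable N"
    using assms(2) by (simp add: normal_rv_def)
  show ?thesis
  proof (cases "AE \<omega> in N. Y \<omega> = 0")
    case True
    have "(\<integral>\<omega>. (Y \<omega>)\<^sup>2 \<partial>N) = (\<integral>\<omega>. 0 \<partial>N)"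
      using True by (intro integral_cong_AE) auto
    moreover have "(CLINT \<omega>|N. iexp (t * Y \<omega>)) = (CLINT \<omega>|N. 1)"
      using True by (intro integral_cong_AE) auto
    then have "char (distr N borel Y) t = (CLINT \<omega>|N. 1)"
      by (simp add: char_def integral_distr)
    ultimately show ?thesis by (simp add: prob_space)
  next
    case False
    then obtain \<sigma> where \<sigma>: "\<sigma> > 0" and D: "distributed N lborel Y (normal_density 0 \<sigma>)"
      using assms(2) by (auto simp: normal_rv_def)
    then show ?thesis
      using char_normal_distributed[OF assms(1) \<sigma> D] normal_distributed_second_moment[OF assms(1) \<sigma> D] by simp
  qed
qed

text \<open>A centred normal density with deviation \<sigma> is at most
  \<open>1 / (2 * \<sigma>)\<close>, since 2 is below the square root of 2 pi. The interval from
  -\<eta> to \<eta> then has probability at most \<eta> / \<sigma>, and a probability of at least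
  1/2 forces \<sigma> to be at most twice \<eta>.\<close>

lemma normal_rv_small_ball:
  assumes "prob_space N" "normal_rv N Y 0"
    and half: "1 / 2 \<le> measure N {\<omega> \<in> space N. \<bar>Y \<omega>\<bar> \<le> \<eta>}"
  shows "(\<integral>\<omega>. (Y \<omega>)\<^sup>2 \<partial>N) \<le> (2 * \<eta>)\<^sup>2"
proof -
  interpret prob_space N by fact
  have m[measurable]: "Y \<in> borel_measurable N"
    using assms(2) by (simp add: normal_rv_def)
  have "\<eta> \<ge> 0"
  proof (rule ccontr)
    assume "\<not> \<eta> \<ge> 0"
    then have "{\<omega> \<in> space N. \<bar>Y \<omega>\<bar> \<le> \<eta>} = {}" by auto
    with half show False by (metis measure_empty not_one_le_zero half_gt_zero_iff zero_less_one linorder_not_less)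
  qed
  show ?thesis
  proof (cases "AE \<omega> in N. Y \<omega> = 0")
    case True
    have "(\<integral>\<omega>. (Y \<omega>)\<^sup>2 \<partial>N) = (\<integral>\<omega>. 0 \<partial>N)"
      using True by (intro integral_cong_AE) auto
    then show ?thesis by simp
  next
    case False
    then obtain \<sigma> where \<sigma>: "\<sigma> > 0" and D: "distributed N lborel Y (normal_density 0 \<sigma>)"
      using assms(2) by (auto simp: normal_rv_def)
    have "(2::real)\<^sup>2 \<le> 2 * pi" using pi_ge_two by simp
    then have s: "2 \<le> sqrt (2 * pi)" by (intro real_le_rsqrt)
    have bound: "normal_density 0 \<sigma> x \<le> 1 / (2 * \<sigma>)" for x
    proof -
      have "normal_density 0 \<sigma> x \<le> 1 / sqrt (2 * pi * \<sigma>\<^sup>2)"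
        unfolding normal_density_def using \<sigma>
        by (intro mult_left_le) (auto)
      also have "sqrt (2 * pi * \<sigma>\<^sup>2) = sqrt (2 * pi) * \<sigma>"
        using \<sigma> by (simp add: real_sqrt_mult)
      also have "1 / (sqrt (2 * pi) * \<sigma>) \<le> 1 / (2 * \<sigma>)"
        using s \<sigma> by (intro divide_left_mono mult_right_mono) auto
      finally show ?thesis .
    qed
    have "{\<omega> \<in> space N. \<bar>Y \<omega>\<bar> \<le> \<eta>} = Y -` {- \<eta>..\<eta>} \<inter> space N" by auto
    then have "emeasure N {\<omega> \<in> space N. \<bar>Y \<omega>\<bar> \<le> \<eta>} =
        (\<integral>\<^sup>+x. ennreal (normal_density 0 \<sigma> x) * indicator {- \<eta>..\<eta>} x \<partial>lborel)"
      using distributed_emeasure[OF D, of "{- \<eta>..\<eta>}"] by simp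
    also have "\<dots> \<le> (\<integral>\<^sup>+x. ennreal (1 / (2 * \<sigma>)) * indicator {- \<eta>..\<eta>} x \<partial>lborel)"
      using bound by (intro nn_integral_mono) (auto split: split_indicator simp: ennreal_leI)
    also have "\<dots> = ennreal (\<eta> / \<sigma>)"
      using \<open>\<eta> \<ge> 0\<close> \<sigma> by (subst nn_integral_cmult_indicator) (auto simp flip: ennreal_mult)
    finally have "measure N {\<omega> \<in> space N. \<bar>Y \<omega>\<bar> \<le> \<eta>} \<le> \<eta> / \<sigma>"
      using \<open>\<eta> \<ge> 0\<close> \<sigma> by (simp add: emeasure_eq_measure)
    with half have "1 / 2 \<le> \<eta> / \<sigma>" by linarith
    then have "\<sigma> \<le> 2 * \<eta>" using \<sigma> by (simp add: field_simps)
    then have "\<sigma>\<^sup>2 \<le> (2 * \<eta>)\<^sup>2"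
      using \<sigma> by (intro power_mono) auto
    then show ?thesis
      by (simp only: normal_distributed_second_moment[OF assms(1) \<sigma> D])
  qed
qed

text \<open>The characteristic functions converge to that of \<open>Z\<close> by dominated
  convergence and to that of a centred normal law of variance \<open>v\<close> by the explicit
  formula; Levy uniqueness identifies the two. For a Brownian bridge the covariance formula supplies
  the convergence of the variances.\<close>

lemma normal_rv_AE_limit:
  assumes "prob_space N" and normal: "\<And>n. normal_rv N (Y n) 0"
    and [measurable]: "Z \<in> borel_measurable N"
    and lim: "AE \<omega> in N. (\<lambda>n. Y n \<omega>) \<longlonglongrightarrow> Z \<omega>"
    and var: "(\<lambda>n. \<integral>\<omega>. (Y n \<omega>)\<^sup>2 \<partial>N) \<longlonglongrightarrow> v"
  shows "normal_rv N Z 0" "(\<integral>\<omega>. (Z \<omega>)\<^sup>2 \<partial>N) = v"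
proof -
  interpret prob_space N by fact
  have [measurable]: "Y n \<in> borel_measurable N" for n
    using normal by (simp add: normal_rv_def)
  have v0: "v \<ge> 0"
    using var by (rule LIMSEQ_le_const) auto
  have "char (distr N borel Z) t = exp (- (v * t\<^sup>2) / 2)" for t
  proof (rule LIMSEQ_unique)
    have "(\<lambda>n. CLINT \<omega>|N. iexp (t * Y n \<omega>)) \<longlonglongrightarrow> (CLINT \<omega>|N. iexp (t * Z \<omega>))"
    proof (rule integral_dominated_convergence)
      show "AE \<omega> in N. (\<lambda>n. iexp (t * Y n \<omega>)) \<longlonglongrightarrow> iexp (t * Z \<omega>)"
        using lim by eventually_elim (auto intro!: tendsto_intros)
      show "integrable N (\<lambda>_. 1::real)" by simp
    qed auto
    then show "(\<lambda>n. char (distr N borel (Y n)) t) \<longlonglongrightarrow> char (distr N borel Z) t"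
      by (simp add: char_def integral_distr)
    have "(\<lambda>n. exp (- ((\<integral>\<omega>. (Y n \<omega>)\<^sup>2 \<partial>N) * t\<^sup>2) / 2)) \<longlonglongrightarrow> exp (- (v * t\<^sup>2) / 2)"
      by (intro tendsto_intros var) auto
    then show "(\<lambda>n. char (distr N borel (Y n)) t) \<longlonglongrightarrow> complex_of_real (exp (- (v * t\<^sup>2) / 2))"
      unfolding char_normal_rv[OF assms(1) normal] by (rule tendsto_of_real)
  qed
  then have char: "char (distr N borel Z) = (\<lambda>t. of_real (exp (- (v * t\<^sup>2) / 2)))" by auto
  have "normal_rv N Z 0 \<and> (\<integral>\<omega>. (Z \<omega>)\<^sup>2 \<partial>N) = v"
  proof (cases "v = 0")
    case True
    \<comment> \<open>For \<open>v = 0\<close> the limiting characteristic function is constantly 1,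
      that of the constant 0, so \<open>Z\<close> falls under the degenerate alternative of
      \<open>normal_rv\<close>.\<close>
    have "distr N borel Z = distr N borel (\<lambda>_. 0)"
      by (rule Levy_uniqueness) (auto simp: char True char_def integral_distr prob_space simp del: distr_const)
    then have "(AE x in distr N borel Z. x = 0) \<longleftrightarrow> (AE x in distr N borel (\<lambda>_. 0). x = (0::real))"
      by (simp only: \<open>distr N borel Z = _\<close>)
    then have Z0: "AE \<omega> in N. Z \<omega> = 0"
      by (simp add: AE_distr_iff del: distr_const)
    then have "(\<integral>\<omega>. (Z \<omega>)\<^sup>2 \<partial>N) = (\<integral>\<omega>. 0 \<partial>N)"
      by (intro integral_cong_AE) auto
    with Z0 True show ?thesis by (auto simp: normal_rv_def)
  next
    case False
    define \<sigma> where "\<sigma> = sqrt v"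
    have \<sigma>: "\<sigma> > 0" "\<sigma>\<^sup>2 = v" using v0 False by (auto simp: \<sigma>_def)
    \<comment> \<open>The reference law is the normal density measure with the identity as its
      variable, so that the formula for normal variables also gives its characteristic
      function.\<close>
    let ?D = "density lborel (\<lambda>x. ennreal (normal_density 0 \<sigma> x))"
    interpret D: prob_space ?D using prob_space_normal_density[OF \<sigma>(1)] by simp
    have D: "distributed ?D lborel (\<lambda>x. x) (normal_density 0 \<sigma>)"
      by (auto simp: distributed_def distr_id2)
    have "char ?D t = exp (- (v * t\<^sup>2) / 2)" for t
      using char_normal_distributed[OF D.prob_space_axioms \<sigma>(1) D, of t]
      by (simp add: \<sigma> distr_id2)
    moreover have "prob_space (distr N borel Z)"
      by (rule prob_space_distr) simp
    ultimately have "distr N borel Z = ?D"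
      by (intro Levy_uniqueness)
        (auto simp: char real_distribution_def real_distribution_axioms_def D.prob_space_axioms)
    then have "distributed N lborel Z (normal_density 0 \<sigma>)"
      by (auto simp: distributed_def cong: distr_cong)
    then show ?thesis
      using normal_distributed_second_moment[OF assms(1) \<sigma>(1)] \<sigma> by (auto simp: normal_rv_def)
  qed
  then show "normal_rv N Z 0" "(\<integral>\<omega>. (Z \<omega>)\<^sup>2 \<partial>N) = v" by auto
qed

section \<open>The space \<open>L\<^sup>2(P)\<close> and extension by continuity\<close>

lemma L2_funs_prod_integrable:
  assumes "f \<in> L2_funs P" "g \<in> L2_funs P"
  shows "integrable P (\<lambda>z. f z * g z)"
proof (rule Bochner_Integration.integrable_bound)
  show "integrable P (\<lambda>z. (f z)\<^sup>2 + (g z)\<^sup>2)"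
    using assms by (simp add: L2_funs_def)
  have "\<bar>a * b\<bar> \<le> a\<^sup>2 + b\<^sup>2" for a b :: real
  proof -
    have "2 * (\<bar>a\<bar> * \<bar>b\<bar>) \<le> a\<^sup>2 + b\<^sup>2" "0 \<le> \<bar>a\<bar> * \<bar>b\<bar>"
      using sum_squares_bound[of "\<bar>a\<bar>" "\<bar>b\<bar>"] by (simp_all add: mult.assoc)
    then show ?thesis
      unfolding abs_mult by linarith
  qed
  then show "AE z in P. norm (f z * g z) \<le> norm ((f z)\<^sup>2 + (g z)\<^sup>2)"
    by simp
qed (use assms in \<open>auto simp: L2_funs_def\<close>)

lemma L2_funs_diff:
  assumes "f \<in> L2_funs P" "g \<in> L2_funs P"
  shows "(\<lambda>z. f z - g z) \<in> L2_funs P"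
  using assms L2_funs_prod_integrable[OF assms]
  by (auto simp: L2_funs_def power2_diff mult.assoc)

lemma L2_funs_integrable:
  assumes "prob_space P" "f \<in> L2_funs P"
  shows "integrable P f"
  using finite_measure.square_integrable_imp_integrable[of P f] assms prob_space.finite_measure
  by (auto simp: L2_funs_def)

lemma L2_dist_nonneg [simp]: "0 \<le> L2_dist P f g"
  by (simp add: L2_dist_def)

lemma L2_dist_commute: "L2_dist P f g = L2_dist P g f"
  by (simp add: L2_dist_def power2_commute)

lemma L2_dist_squared: "(L2_dist P f g)\<^sup>2 = (\<integral>z. (f z - g z)\<^sup>2 \<partial>P)"
  by (simp add: L2_dist_def)

lemma integral_squared_le:
  assumes "prob_space P" "f \<in> L2_funs P"
  shows "(\<integral>z. f z \<partial>P)\<^sup>2 \<le> (\<integral>z. (f z)\<^sup>2 \<partial>P)"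
proof -
  interpret prob_space P by fact
  show ?thesis
    using variance_positive[of f] variance_eq[of f] assms(2) L2_funs_integrable[OF assms]
    unfolding L2_funs_def mem_Collect_eq by linarith
qed

text \<open>Nonnegativity of the variance of |f - g| gives the first bound. It serves the
  completeness proof, which sums L^1 distances; the second makes the mean continuous in L^2.\<close>

lemma integral_abs_diff_le_L2_dist:
  assumes "prob_space P" "f \<in> L2_funs P" "g \<in> L2_funs P"
  shows "(\<integral>z. \<bar>f z - g z\<bar> \<partial>P) \<le> L2_dist P f g"
    and "\<bar>(\<integral>z. f z \<partial>P) - (\<integral>z. g z \<partial>P)\<bar> \<le> L2_dist P f g"
proof -
  have "(\<lambda>z. \<bar>f z - g z\<bar>) \<in> L2_funs P"
    using L2_funs_diff[OF assms(2,3)] by (auto simp: L2_funs_def)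
  from integral_squared_le[OF assms(1) this]
  show *: "(\<integral>z. \<bar>f z - g z\<bar> \<partial>P) \<le> L2_dist P f g"
    by (simp add: L2_dist_def real_le_rsqrt)
  show "\<bar>(\<integral>z. f z \<partial>P) - (\<integral>z. g z \<partial>P)\<bar> \<le> L2_dist P f g"
    using * integral_abs_bound[of P "\<lambda>z. f z - g z"] L2_funs_integrable[OF assms(1)] assms
    by simp
qed

lemma L2_dist_eq_0_imp_AE:
  assumes "f \<in> L2_funs P" "g \<in> L2_funs P" "L2_dist P f g = 0"
  shows "AE z in P. f z = g z"
proof -
  have "integrable P (\<lambda>z. (f z - g z)\<^sup>2)"
    using L2_funs_diff assms by (auto simp: L2_funs_def)
  then show ?thesis
    using integral_nonneg_eq_0_iff_AE[of P "\<lambda>z. (f z - g z)\<^sup>2"] assms(3) by (simp add: L2_dist_def)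
qed

lemma L2_dist_AE_cong:
  assumes "f \<in> L2_funs P" "g \<in> L2_funs P" "g' \<in> L2_funs P" "AE z in P. g z = g' z"
  shows "L2_dist P f g = L2_dist P f g'"
  unfolding L2_dist_def using assms
  by (intro arg_cong[where f = sqrt] integral_cong_AE) (auto simp: L2_funs_def)

text \<open>Minkowski's inequality from a weighted pointwise bound whose weights depend on the
  distances \<open>a\<close> and \<open>b\<close> themselves: its integral is exactly
  \<open>(a + b)\<^sup>2\<close>. The weights require positive distances; a vanishing distance means
  equality almost everywhere and is treated separately.\<close>

lemma L2_dist_triangle:
  assumes L2: "f \<in> L2_funs P" "g \<in> L2_funs P" "h \<in> L2_funs P"
  shows "L2_dist P f h \<le> L2_dist P f g + L2_dist P g h"
proof -
  define a b where "a = L2_dist P f g" and "b = L2_dist P g h"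
  consider "a = 0" | "b = 0" | "a > 0" "b > 0"
    unfolding a_def b_def by (metis L2_dist_nonneg order_le_less)
  then have "L2_dist P f h \<le> a + b"
  proof cases
    case 1
    then have "L2_dist P h f = L2_dist P h g"
      using L2 by (intro L2_dist_AE_cong L2_dist_eq_0_imp_AE) (auto simp: a_def)
    then show ?thesis
      using 1 by (simp add: b_def L2_dist_commute)
  next
    case 2
    then have "L2_dist P f g = L2_dist P f h"
      using L2 by (intro L2_dist_AE_cong L2_dist_eq_0_imp_AE) (auto simp: b_def)
    then show ?thesis
      using 2 by (simp add: a_def)
  next
    case 3
    have i: "integrable P (\<lambda>z. (f z - g z)\<^sup>2)" "integrable P (\<lambda>z. (g z - h z)\<^sup>2)"
      "integrable P (\<lambda>z. (f z - h z)\<^sup>2)"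
      using L2_funs_diff L2 by (auto simp: L2_funs_def)
    have "(x + y)\<^sup>2 \<le> (1 + b / a) * x\<^sup>2 + (1 + a / b) * y\<^sup>2" for x y
    proof -
      \<comment> \<open>This square is the slack in the weighted bound.\<close>
      have "0 \<le> (b * x - a * y)\<^sup>2 / (a * b)"
        using 3 by simp
      also have "\<dots> = (1 + b / a) * x\<^sup>2 + (1 + a / b) * y\<^sup>2 - (x + y)\<^sup>2"
        using 3 by (simp add: field_simps power2_eq_square)
      finally show ?thesis by simp
    qed
    then have "(f z - h z)\<^sup>2 \<le> (1 + b / a) * (f z - g z)\<^sup>2 + (1 + a / b) * (g z - h z)\<^sup>2" for z
      by (metis diff_add_cancel add_diff_eq)
    then have "(\<integral>z. (f z - h z)\<^sup>2 \<partial>P) \<le> (\<integral>z. (1 + b / a) * (f z - g z)\<^sup>2 + (1 + a / b) * (g z - h z)\<^sup>2 \<partial>P)"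
      using i by (intro integral_mono) auto
    also have "\<dots> = (1 + b / a) * a\<^sup>2 + (1 + a / b) * b\<^sup>2"
      using i by (simp add: L2_dist_squared a_def b_def)
    also have "\<dots> = a * (a + b) + b * (a + b)"
      using 3 by (simp add: distrib_left distrib_right power2_eq_square)
    also have "\<dots> = (a + b)\<^sup>2"
      by (simp add: power2_eq_square distrib_right)
    finally have "(L2_dist P f h)\<^sup>2 \<le> (a + b)\<^sup>2"
      by (simp only: L2_dist_squared)
    then show ?thesis
      by (rule power2_le_imp_le) (use 3 in simp)
  qed
  then show ?thesis by (simp add: a_def b_def)
qed

lemma L2_dist_tendsto:
  assumes L2: "\<And>n. f n \<in> L2_funs P" "\<And>n. f' n \<in> L2_funs P" "g \<in> L2_funs P" "g' \<in> L2_funs P"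
    and lim: "(\<lambda>n. L2_dist P (f n) g) \<longlonglongrightarrow> 0" "(\<lambda>n. L2_dist P (f' n) g') \<longlonglongrightarrow> 0"
  shows "(\<lambda>n. L2_dist P (f n) (f' n)) \<longlonglongrightarrow> L2_dist P g g'"
proof (rule LIM_zero_cancel, rule Lim_null_comparison)
  show "(\<lambda>n. L2_dist P (f n) g + L2_dist P (f' n) g') \<longlonglongrightarrow> 0"
    using tendsto_add[OF lim] by simp
  have "\<bar>L2_dist P (f n) (f' n) - L2_dist P g g'\<bar> \<le> L2_dist P (f n) g + L2_dist P (f' n) g'" for n
    using L2_dist_triangle[of "f n" P g "f' n"] L2_dist_triangle[of g P g' "f' n"]
      L2_dist_triangle[of g P "f n" g'] L2_dist_triangle[of "f n" P "f' n" g'] L2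
      L2_dist_commute[of P g "f n"] L2_dist_commute[of P g' "f' n"]
    by force
  then show "\<forall>\<^sub>F n in sequentially. norm (L2_dist P (f n) (f' n) - L2_dist P g g')
      \<le> L2_dist P (f n) g + L2_dist P (f' n) g'"
    by simp
qed

section \<open>Completeness of L^2(P)\<close>

lemma AE_summable_if_summable_integral:
  fixes h :: "nat \<Rightarrow> 'a \<Rightarrow> real"
  assumes h: "\<And>n. integrable P (h n)" "\<And>n z. h n z \<ge> 0" and s: "summable (\<lambda>n. \<integral>z. h n z \<partial>P)"
  shows "AE z in P. summable (\<lambda>n. h n z)"
proof -
  have [measurable]: "h n \<in> borel_measurable P" for n
    using h(1) by auto
  have "(\<integral>\<^sup>+z. (\<Sum>n. ennreal (h n z)) \<partial>P) = (\<Sum>n. \<integral>\<^sup>+z. ennreal (h n z) \<partial>P)"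
    by (rule nn_integral_suminf) measurable
  also have "\<dots> = (\<Sum>n. ennreal (\<integral>z. h n z \<partial>P))"
    using h by (simp add: nn_integral_eq_integral)
  also have "\<dots> = ennreal (\<Sum>n. \<integral>z. h n z \<partial>P)"
    using s h by (intro suminf_ennreal2) auto
  finally have "(\<integral>\<^sup>+z. (\<Sum>n. ennreal (h n z)) \<partial>P) \<noteq> \<infinity>" by simp
  then have "AE z in P. (\<Sum>n. ennreal (h n z)) \<noteq> \<infinity>"
    by (intro nn_integral_noteq_infinite) auto
  then show ?thesis
    by eventually_elim (auto intro!: summable_suminf_not_top h(2))
qed

text \<open>The Riesz-Fischer argument: a rapidly Cauchy subsequence converges almost everywhere,
  and Fatou's lemma along it turns the Cauchy property into L^2 convergence of the whole
  sequence.\<close>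

lemma L2_complete:
  assumes P: "prob_space P" and f: "\<And>n. f n \<in> L2_funs P"
    and cauchy: "\<And>\<epsilon>. \<epsilon> > 0 \<Longrightarrow> \<exists>n0. \<forall>m\<ge>n0. \<forall>n\<ge>n0. L2_dist P (f m) (f n) < \<epsilon>"
  obtains g where "g \<in> L2_funs P" "(\<lambda>n. L2_dist P (f n) g) \<longlonglongrightarrow> 0"
proof -
  interpret prob_space P by fact
  have [measurable]: "f n \<in> borel_measurable P" for n
    using f by (auto simp: L2_funs_def)
  have d2: "integrable P (\<lambda>z. (f m z - f n z)\<^sup>2)" for m n
    using L2_funs_diff[OF f f] by (auto simp: L2_funs_def)
  have "\<forall>k. \<exists>n0. \<forall>m\<ge>n0. \<forall>n\<ge>n0. L2_dist P (f m) (f n) < (1 / 2) ^ k"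
    by (intro allI cauchy) auto
  then obtain b where b: "\<And>k m n. m \<ge> b k \<Longrightarrow> n \<ge> b k \<Longrightarrow> L2_dist P (f m) (f n) < (1 / 2) ^ k"
    by metis
  \<comment> \<open>The sum makes both \<open>s k\<close> and \<open>s (Suc k)\<close> at least
    \<open>b k\<close>, so consecutive members differ by less than \<open>(1 / 2) ^ k\<close>; the
    summand \<open>k\<close> makes the indices tend to infinity.\<close>
  define s where "s k = k + (\<Sum>i\<le>k. b i)" for k
  have "b k \<le> sum b {..k}" for k
    by (rule member_le_sum) auto
  then have s: "b k \<le> s k" "b k \<le> s (Suc k)" "k \<le> s k" for k
    by (simp_all add: s_def trans_le_add1 trans_le_add2 le_SucI)
  define g where "g z = lim (\<lambda>k. f (s k) z)" for z
  have [measurable]: "g \<in> borel_measurable P"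
    unfolding g_def by measurable
  have "AE z in P. summable (\<lambda>k. \<bar>f (s (Suc k)) z - f (s k) z\<bar>)"
  proof (rule AE_summable_if_summable_integral)
    show "integrable P (\<lambda>z. \<bar>f (s (Suc k)) z - f (s k) z\<bar>)" for k
      using L2_funs_integrable[OF P f] by auto
    show "summable (\<lambda>k. \<integral>z. \<bar>f (s (Suc k)) z - f (s k) z\<bar> \<partial>P)"
    proof (rule summable_comparison_test')
      show "summable (\<lambda>k. (1 / 2 :: real) ^ k)" by simp
      show "norm (\<integral>z. \<bar>f (s (Suc k)) z - f (s k) z\<bar> \<partial>P) \<le> (1 / 2) ^ k" for k
        using integral_abs_diff_le_L2_dist(1)[OF P f f, of "s (Suc k)" "s k"] b[of k "s (Suc k)" "s k"] s[of k]
        by simp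
    qed
  qed simp
  then have lim: "AE z in P. (\<lambda>k. f (s k) z) \<longlonglongrightarrow> g z"
  proof eventually_elim
    fix z assume "summable (\<lambda>k. \<bar>f (s (Suc k)) z - f (s k) z\<bar>)"
    then have "summable (\<lambda>k. f (s (Suc k)) z - f (s k) z)"
      by (rule summable_rabs_cancel)
    then have "convergent (\<lambda>n. \<Sum>k<n. f (s (Suc k)) z - f (s k) z)"
      by (simp add: summable_iff_convergent)
    then have "convergent (\<lambda>n. f (s n) z - f (s 0) z)"
      by (simp add: sum_lessThan_telescope[where f = "\<lambda>k. f (s k) z"])
    then have "convergent (\<lambda>n. (f (s n) z - f (s 0) z) + f (s 0) z)"
      by (intro convergent_add convergent_const)
    then show "(\<lambda>k. f (s k) z) \<longlonglongrightarrow> g z"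
      by (simp add: g_def convergent_LIMSEQ_iff)
  qed
  \<comment> \<open>The index \<open>n\<close> stays fixed while the second index runs along the
    subsequence, so the bound holds for members of the original sequence.\<close>
  have fatou: "(\<integral>\<^sup>+z. ennreal ((f n z - g z)\<^sup>2) \<partial>P) \<le> ennreal (e\<^sup>2)"
    if e: "\<And>m. m \<ge> n0 \<Longrightarrow> L2_dist P (f n) (f m) \<le> e" for n n0 e
  proof -
    have "(\<integral>\<^sup>+z. ennreal ((f n z - g z)\<^sup>2) \<partial>P)
        = (\<integral>\<^sup>+z. liminf (\<lambda>k. ennreal ((f n z - f (s k) z)\<^sup>2)) \<partial>P)"
    proof (rule nn_integral_cong_AE, use lim in eventually_elim)
      case (elim z)
      then have "(\<lambda>k. ennreal ((f n z - f (s k) z)\<^sup>2)) \<longlonglongrightarrow> ennreal ((f n z - g z)\<^sup>2)"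
        by (intro tendsto_intros)
      from lim_imp_Liminf[OF _ this] show ?case
        by simp
    qed
    also have "\<dots> \<le> liminf (\<lambda>k. \<integral>\<^sup>+z. ennreal ((f n z - f (s k) z)\<^sup>2) \<partial>P)"
      by (rule nn_integral_liminf) measurable
    also have "\<dots> \<le> limsup (\<lambda>k. \<integral>\<^sup>+z. ennreal ((f n z - f (s k) z)\<^sup>2) \<partial>P)"
      by (rule Liminf_le_Limsup) simp
    also have "\<dots> \<le> ennreal (e\<^sup>2)"
    proof (rule Limsup_bounded)
      show "\<forall>\<^sub>F k in sequentially. (\<integral>\<^sup>+z. ennreal ((f n z - f (s k) z)\<^sup>2) \<partial>P) \<le> ennreal (e\<^sup>2)"
        using eventually_ge_at_top[of n0]
      proof eventually_elim
        case (elim k)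
        then have "(L2_dist P (f n) (f (s k)))\<^sup>2 \<le> e\<^sup>2"
          using e[of "s k"] s(3)[of k] by (intro power_mono) auto
        then show ?case
          by (simp add: nn_integral_eq_integral d2 L2_dist_squared ennreal_leI)
      qed
    qed
    finally show ?thesis .
  qed
  have tail: "\<exists>n0. \<forall>n\<ge>n0. (\<integral>\<^sup>+z. ennreal ((f n z - g z)\<^sup>2) \<partial>P) \<le> ennreal (e\<^sup>2)" if "e > 0" for e
    using cauchy[OF that] fatou[of _ _ e] by (meson less_imp_le)
  have int: "integrable P (\<lambda>z. (f n z - g z)\<^sup>2)" if "(\<integral>\<^sup>+z. ennreal ((f n z - g z)\<^sup>2) \<partial>P) \<le> ennreal (e\<^sup>2)" for n e
    using that by (intro integrableI_nonneg) (auto simp: order_le_less_trans)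
  \<comment> \<open>One index with a finite bound suffices for \<open>g\<close> to be square
    integrable, because \<open>g\<close> is \<open>f n\<close> minus the difference
    \<open>f n - g\<close>.\<close>
  obtain n where "(\<integral>\<^sup>+z. ennreal ((f n z - g z)\<^sup>2) \<partial>P) \<le> ennreal (1\<^sup>2)"
    using tail[of 1] by auto
  then have "(\<lambda>z. f n z - g z) \<in> L2_funs P"
    using int[of n 1] by (simp add: L2_funs_def)
  from L2_funs_diff[OF f[of n] this] have g: "g \<in> L2_funs P"
    by simp
  have "(\<lambda>n. L2_dist P (f n) g) \<longlonglongrightarrow> 0"
  proof (rule LIMSEQ_I)
    fix r :: real assume "r > 0"
    then obtain n0 where n0: "\<forall>n\<ge>n0. (\<integral>\<^sup>+z. ennreal ((f n z - g z)\<^sup>2) \<partial>P) \<le> ennreal ((r / 2)\<^sup>2)"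
      using tail[of "r / 2"] by auto
    have "L2_dist P (f n) g < r" if "n \<ge> n0" for n
    proof -
      have "(L2_dist P (f n) g)\<^sup>2 \<le> (r / 2)\<^sup>2"
      proof -
        have le: "(\<integral>\<^sup>+z. ennreal ((f n z - g z)\<^sup>2) \<partial>P) \<le> ennreal ((r / 2)\<^sup>2)"
          using n0 that by blast
        have "ennreal ((L2_dist P (f n) g)\<^sup>2) = (\<integral>\<^sup>+z. ennreal ((f n z - g z)\<^sup>2) \<partial>P)"
          unfolding L2_dist_squared by (intro nn_integral_eq_integral[symmetric] int[OF le]) simp
        with le show ?thesis
          by (metis ennreal_le_iff zero_le_power2)
      qed
      then have "L2_dist P (f n) g \<le> r / 2"
        by (rule power2_le_imp_le) (use \<open>r > 0\<close> in simp)
      with \<open>r > 0\<close> show ?thesis by simp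
    qed
    then show "\<exists>n0. \<forall>n\<ge>n0. norm (L2_dist P (f n) g - 0) < r" by auto
  qed
  with g that show ?thesis by blast
qed

section \<open>Extension by continuity along sequences\<close>

text \<open>This replaces the filter limit in \<open>extend_cont\<close> by a limit along any
  approximating sequence. Uniform continuity makes \<open>u (f n)\<close> Cauchy, and any two
  members of \<open>F\<close> close enough to \<open>g\<close> have close values, so the filter has
  the same limit as the sequence.\<close>

lemma extend_cont_tendsto:
  assumes P: "prob_space P" and F: "F \<subseteq> L2_funs P" and u: "L2_uniformly_continuous P F u"
    and g: "g \<in> L2_funs P" and f: "\<And>n. f n \<in> F" and lim: "(\<lambda>n. L2_dist P (f n) g) \<longlonglongrightarrow> 0"
  shows "(\<lambda>n. u (f n)) \<longlonglongrightarrow> extend_cont P F u (ae_eq_rel P `` {g})"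
proof -
  have near: "\<exists>\<delta>>0. \<forall>h\<in>F. \<forall>h'\<in>F. L2_dist P h g < \<delta> \<longrightarrow> L2_dist P h' g < \<delta> \<longrightarrow> \<bar>u h - u h'\<bar> < \<epsilon>"
    if \<epsilon>: "\<epsilon> > 0" for \<epsilon>
  proof -
    obtain \<delta> where \<delta>: "\<delta> > 0" "\<And>h h'. h \<in> F \<Longrightarrow> h' \<in> F \<Longrightarrow> L2_dist P h h' < \<delta> \<Longrightarrow> \<bar>u h - u h'\<bar> < \<epsilon>"
      using u \<epsilon> unfolding L2_uniformly_continuous_def by metis
    have "L2_dist P h h' < \<delta>" if "h \<in> F" "h' \<in> F" "L2_dist P h g < \<delta> / 2" "L2_dist P h' g < \<delta> / 2" for h h'
      using L2_dist_triangle[of h P g h'] that F g L2_dist_commute[of P g h'] by force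
    with \<delta> show ?thesis by (intro exI[of _ "\<delta> / 2"]) auto
  qed
  have "Cauchy (\<lambda>n. u (f n))"
  proof (rule metric_CauchyI)
    fix \<epsilon> :: real assume "\<epsilon> > 0"
    from near[OF this] obtain \<delta> where \<delta>: "\<delta> > 0"
      "\<And>h h'. h \<in> F \<Longrightarrow> h' \<in> F \<Longrightarrow> L2_dist P h g < \<delta> \<Longrightarrow> L2_dist P h' g < \<delta> \<Longrightarrow> \<bar>u h - u h'\<bar> < \<epsilon>"
      by metis
    obtain n0 where "\<And>n. n \<ge> n0 \<Longrightarrow> L2_dist P (f n) g < \<delta>"
      using order_tendstoD(2)[OF lim \<delta>(1)] by (auto simp: eventually_sequentially)
    with \<delta>(2) f show "\<exists>M. \<forall>m\<ge>M. \<forall>n\<ge>M. dist (u (f m)) (u (f n)) < \<epsilon>"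
      by (intro exI[of _ n0]) (auto simp: dist_real_def)
  qed
  then obtain l where l: "(\<lambda>n. u (f n)) \<longlonglongrightarrow> l"
    using real_Cauchy_convergent convergent_def by blast
  let ?A = "\<lambda>\<delta>. {f \<in> F. \<forall>g'\<in>ae_eq_rel P `` {g}. L2_dist P f g' < \<delta>}"
  let ?\<F> = "INF \<delta>\<in>{0<..}. principal (?A \<delta>)"
  \<comment> \<open>The distance to a class does not depend on the representative, so the sets
    generating the filter are the balls about \<open>g\<close> within \<open>F\<close>.\<close>
  have cong: "L2_dist P h g' = L2_dist P h g" if "h \<in> F" "(g, g') \<in> ae_eq_rel P" for h g'
    using that F L2_dist_AE_cong[of h P g g'] by (auto simp: ae_eq_rel_def)
  have A: "?A \<delta> = {h \<in> F. L2_dist P h g < \<delta>}" for \<delta>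
  proof -
    have "(g, g) \<in> ae_eq_rel P"
      using g by (simp add: ae_eq_rel_def)
    then have "(\<forall>g'\<in>ae_eq_rel P `` {g}. L2_dist P h g' < \<delta>) \<longleftrightarrow> L2_dist P h g < \<delta>" if "h \<in> F" for h
      using cong[OF that] by (metis Image_singleton_iff)
    then show ?thesis by blast
  qed
  have ev: "eventually Q ?\<F> \<longleftrightarrow> (\<exists>\<delta>>0. \<forall>h\<in>?A \<delta>. Q h)" for Q
    unfolding A
  proof (subst eventually_INF_base)
    fix a b :: real assume "a \<in> {0<..}" "b \<in> {0<..}"
    then show "\<exists>x\<in>{0<..}. principal {h \<in> F. L2_dist P h g < x}
        \<le> inf (principal {h \<in> F. L2_dist P h g < a}) (principal {h \<in> F. L2_dist P h g < b})"
      by (intro bexI[of _ "min a b"]) auto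
  qed (auto simp: eventually_principal)
  have ex: "\<exists>n. f n \<in> ?A \<delta> \<and> \<bar>u (f n) - l\<bar> < \<epsilon>" if "\<delta> > 0" "\<epsilon> > 0" for \<delta> \<epsilon>
  proof -
    have "\<forall>\<^sub>F n in sequentially. dist (u (f n)) l < \<epsilon>"
      using l that by (simp add: tendsto_iff)
    moreover have "\<forall>\<^sub>F n in sequentially. L2_dist P (f n) g < \<delta>"
      using order_tendstoD(2)[OF lim] that by simp
    ultimately have "\<forall>\<^sub>F n in sequentially. dist (u (f n)) l < \<epsilon> \<and> L2_dist P (f n) g < \<delta>"
      by (rule eventually_conj)
    then obtain n where "dist (u (f n)) l < \<epsilon>" "L2_dist P (f n) g < \<delta>"
      by (auto simp: eventually_sequentially)
    then show ?thesis using f unfolding A by (auto simp: dist_real_def)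
  qed
  \<comment> \<open>Uniqueness of the limit selected by \<open>Lim\<close> requires a nontrivial
    filter; every ball contains some \<open>f n\<close>.\<close>
  have "?\<F> \<noteq> bot"
  proof
    assume "?\<F> = bot"
    then have "eventually (\<lambda>_. False) ?\<F>" by simp
    then obtain \<delta> where "\<delta> > 0" "\<forall>h\<in>?A \<delta>. False"
      unfolding ev by (elim exE conjE)
    with ex[of \<delta> 1] show False
      by (meson zero_less_one)
  qed
  moreover have "(u \<longlongrightarrow> l) ?\<F>"
  proof (rule tendstoI)
    fix \<epsilon> :: real assume "\<epsilon> > 0"
    then have "\<epsilon> / 2 > 0" by simp
    from near[OF this] obtain \<delta> where \<delta>: "\<delta> > 0"
      "\<And>h h'. h \<in> F \<Longrightarrow> h' \<in> F \<Longrightarrow> L2_dist P h g < \<delta> \<Longrightarrow> L2_dist P h' g < \<delta> \<Longrightarrow> \<bar>u h - u h'\<bar> < \<epsilon> / 2"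
      by metis
    obtain n where n: "f n \<in> ?A \<delta>" "\<bar>u (f n) - l\<bar> < \<epsilon> / 2"
      using ex[OF \<delta>(1) \<open>\<epsilon> / 2 > 0\<close>] by auto
    have "dist (u h) l < \<epsilon>" if "h \<in> ?A \<delta>" for h
    proof -
      have "\<bar>u h - u (f n)\<bar> < \<epsilon> / 2"
        using that n(1) unfolding A by (intro \<delta>(2)) auto
      with n(2) show ?thesis
        unfolding dist_real_def by linarith
    qed
    with \<delta>(1) show "\<forall>\<^sub>F h in ?\<F>. dist (u h) l < \<epsilon>"
      unfolding ev by blast
  qed
  ultimately have "extend_cont P F u (ae_eq_rel P `` {g}) = l"
    unfolding extend_cont_def by (rule tendsto_Lim)
  with l show ?thesis by simp
qed

lemma in_L2_completionI:
  assumes "g \<in> L2_funs P" "\<And>n. f n \<in> F" "(\<lambda>n. L2_dist P (f n) g) \<longlonglongrightarrow> 0"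
  shows "ae_eq_rel P `` {g} \<in> L2_completion P F"
  unfolding L2_completion_def
proof (rule quotientI, intro CollectI conjI allI impI)
  fix \<epsilon> :: real assume "\<epsilon> > 0"
  from order_tendstoD(2)[OF assms(3) this] obtain n where "L2_dist P (f n) g < \<epsilon>"
    by (auto simp: eventually_sequentially)
  with assms(2) show "\<exists>f\<in>F. L2_dist P f g < \<epsilon>" by blast
qed fact

lemma L2_completionE:
  assumes "q \<in> L2_completion P F"
  obtains g f where "g \<in> L2_funs P" "q = ae_eq_rel P `` {g}"
    "\<forall>n. f n \<in> F" "(\<lambda>n. L2_dist P (f n) g) \<longlonglongrightarrow> 0"
proof -
  obtain g where g: "g \<in> L2_funs P" "q = ae_eq_rel P `` {g}" "\<forall>\<epsilon>>0. \<exists>f\<in>F. L2_dist P f g < \<epsilon>"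
    using assms by (auto simp: L2_completion_def elim!: quotientE)
  have "\<forall>n. \<exists>f\<in>F. L2_dist P f g < inverse (real (Suc n))"
    using g(3) by (simp del: of_nat_Suc)
  then obtain f where f: "\<And>n. f n \<in> F" "\<And>n. L2_dist P (f n) g < inverse (real (Suc n))"
    by metis
  have "(\<lambda>n. L2_dist P (f n) g) \<longlonglongrightarrow> 0"
    by (rule tendsto_sandwich[OF _ _ tendsto_const LIMSEQ_inverse_real_of_nat])
      (auto intro!: always_eventually less_imp_le[OF f(2)] simp del: of_nat_Suc)
  with g f that show ?thesis by blast
qed

lemma ae_eq_rel_Image_eqI:
  assumes "AE z in P. g z = g' z" "g \<in> L2_funs P" "g' \<in> L2_funs P"
  shows "ae_eq_rel P `` {g} = ae_eq_rel P `` {g'}"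
proof -
  have "(AE z in P. g z = h z) \<longleftrightarrow> (AE z in P. g' z = h z)" for h
    using assms(1) by (intro eventually_cong) auto
  with assms(2,3) show ?thesis
    by (auto simp: ae_eq_rel_def)
qed

lemma L2_uniformly_continuous_integral:
  assumes "prob_space P" "F \<subseteq> L2_funs P"
  shows "L2_uniformly_continuous P F (\<lambda>f. \<integral>z. f z \<partial>P)"
  unfolding L2_uniformly_continuous_def
  using integral_abs_diff_le_L2_dist(2)[OF assms(1)] assms(2) by (meson le_less_trans subset_iff)

section \<open>Brownian bridges\<close>

lemma linfty_abs_diff_le:
  assumes "u \<in> mspace (linfty F)" "v \<in> mspace (linfty F)" "f \<in> F"
  shows "\<bar>u f - v f\<bar> \<le> mdist (linfty F) u v"
proof -

  have "dist (u f) (v f) \<le> (SUP f\<in>F. dist (u f) (v f))"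
    using assms by (intro cSUP_upper Met_TC.bdd_above_dist) auto
  then show ?thesis
    using assms by (auto simp: Met_TC.fdist_def dist_real_def)
qed

lemma linfty_bounded:
  assumes "u \<in> mspace (linfty F)"
  obtains B where "B > 0" "\<And>f. f \<in> F \<Longrightarrow> \<bar>u f\<bar> \<le> B"
proof -
  obtain c B where B: "\<forall>f\<in>F. dist c (u f) \<le> B"
    using funspace_imp_bounded[OF assms] by fastforce
  have "\<bar>u f\<bar> \<le> \<bar>c\<bar> + \<bar>B\<bar> + 1" if "f \<in> F" for f
    using B that by (force simp: dist_real_def)
  then show ?thesis
    using that[of "\<bar>c\<bar> + \<bar>B\<bar> + 1"] by auto
qed

lemma space_borel_of_metric: "space (borel_of_metric D) = mspace D"
  using openin_subset[of "mtopology_of D"] unfolding borel_of_metric_def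
  by (intro space_measure_of) auto

lemma brownian_bridge_in_linfty:
  assumes "brownian_bridge P F N G" "\<omega> \<in> space N"
  shows "G \<omega> \<in> mspace (linfty F)"
  using assms measurable_space[of G N "borel_of_metric (linfty F)" \<omega>]
  by (simp add: brownian_bridge_def space_borel_of_metric)

text \<open>\<open>gaussian_process\<close> leaves the mean of each linear combination open; the
  zero-mean clause of the bridge fixes it.\<close>

lemma brownian_bridge_normal:
  assumes "brownian_bridge P F N G" "f \<in> F"
  shows "normal_rv N (\<lambda>\<omega>. G \<omega> f) 0"
proof -
  have N: "prob_space N" and g: "gaussian_process N F G" and z: "zero_mean N (\<lambda>\<omega>. G \<omega> f)"
    using assms by (auto simp: brownian_bridge_def)
  obtain \<mu> where "normal_rv N (\<lambda>\<omega>. \<Sum>i\<in>{f}. 1 * G \<omega> i) \<mu>"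
    using g assms(2) unfolding gaussian_process_def
    by (elim allE[of _ "{f}"] allE[of _ "\<lambda>_. 1"]) auto
  then have \<mu>: "normal_rv N (\<lambda>\<omega>. G \<omega> f) \<mu>" by simp
  with normal_rv_expectation(2)[OF N \<mu>] z show ?thesis
    by (simp add: zero_mean_def)
qed

lemma brownian_bridge_variance:
  assumes "brownian_bridge P F N G" "f \<in> F"
  shows "(\<integral>\<omega>. (G \<omega> f)\<^sup>2 \<partial>N) = (\<integral>z. (f z)\<^sup>2 \<partial>P) - (\<integral>z. f z \<partial>P)\<^sup>2"
  using assms by (simp add: brownian_bridge_def power2_eq_square)

text \<open>The difference is the linear combination over \<open>{f, g}\<close> with coefficients 1
  and -1. For \<open>f = g\<close> the index set collapses to one point, hence the case
  distinction.\<close>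

lemma brownian_bridge_diff_normal:
  assumes "brownian_bridge P F N G" "f \<in> F" "g \<in> F"
  shows "normal_rv N (\<lambda>\<omega>. G \<omega> f - G \<omega> g) 0"
proof (cases "f = g")
  case True
  then show ?thesis by (simp add: normal_rv_def)
next
  case False
  have N: "prob_space N" and gp: "gaussian_process N F G"
    and z: "zero_mean N (\<lambda>\<omega>. G \<omega> f)" "zero_mean N (\<lambda>\<omega>. G \<omega> g)"
    using assms by (auto simp: brownian_bridge_def)
  obtain \<mu> where "normal_rv N (\<lambda>\<omega>. \<Sum>i\<in>{f, g}. (if i = f then 1 else - 1) * G \<omega> i) \<mu>"
    using gp assms(2,3) unfolding gaussian_process_def
    by (elim allE[of _ "{f, g}"] allE[of _ "\<lambda>i. if i = f then 1 else - 1"]) auto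
  then have \<mu>: "normal_rv N (\<lambda>\<omega>. G \<omega> f - G \<omega> g) \<mu>"
    using False by simp
  with normal_rv_expectation(2)[OF N \<mu>] z show ?thesis
    by (simp add: zero_mean_def)
qed

text \<open>The variance of an increment and the squared L^2 distance differ only by the squared
  difference of the means. Small increments therefore control the distance as soon as the means are
  close.\<close>

lemma brownian_bridge_diff_variance:
  assumes P: "prob_space P" and bb: "brownian_bridge P F N G" and fg: "f \<in> F" "g \<in> F"
  shows "(\<integral>\<omega>. (G \<omega> f - G \<omega> g)\<^sup>2 \<partial>N) = (L2_dist P f g)\<^sup>2 - ((\<integral>z. f z \<partial>P) - (\<integral>z. g z \<partial>P))\<^sup>2"
proof -
  have N: "prob_space N" and L2: "f \<in> L2_funs P" "g \<in> L2_funs P"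
    and cov: "(\<integral>\<omega>. G \<omega> f * G \<omega> g \<partial>N) = (\<integral>z. f z * g z \<partial>P) - (\<integral>z. f z \<partial>P) * (\<integral>z. g z \<partial>P)"
    using bb fg by (auto simp: brownian_bridge_def)
  have G: "(\<lambda>\<omega>. G \<omega> h) \<in> L2_funs N" if "h \<in> F" for h
    using normal_rv_integrable_square[OF N] brownian_bridge_normal[OF bb that]
    by (auto simp: L2_funs_def normal_rv_def)
  have expand: "(\<integral>z. (a z - b z)\<^sup>2 \<partial>Q) = (\<integral>z. (a z)\<^sup>2 \<partial>Q) - 2 * (\<integral>z. a z * b z \<partial>Q) + (\<integral>z. (b z)\<^sup>2 \<partial>Q)"
    if "a \<in> L2_funs Q" "b \<in> L2_funs Q" for a b and Q :: "'x measure"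
  proof -
    have "integrable Q (\<lambda>z. a z * b z)"
      using that by (rule L2_funs_prod_integrable)
    then show ?thesis
      using that by (simp add: L2_funs_def power2_diff mult.assoc)
  qed
  show ?thesis
    unfolding L2_dist_squared expand[OF L2] expand[OF G[OF fg(1)] G[OF fg(2)]] cov
      brownian_bridge_variance[OF bb fg(1)] brownian_bridge_variance[OF bb fg(2)]
    by (simp add: power2_diff)
qed

section \<open>Relative compactness of the class from tightness\<close>

text \<open>A compact set \<open>K\<close> of paths has a countable dense subset, and a diagonal
  argument makes its members converge along one subsequence. Finite nets make the oscillation small
  uniformly over \<open>K\<close>, and the small-ball bound turns this into small increment
  variances. Convergence of the means does the rest.\<close>

lemma brownian_bridge_Cauchy_subsequence:
  assumes P: "prob_space P" and bb: "brownian_bridge P F N G"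
    and f: "\<And>n. f n \<in> F" and conv: "convergent (\<lambda>n. \<integral>z. f n z \<partial>P)"
  obtains r :: "nat \<Rightarrow> nat" where "strict_mono r"
    "\<forall>\<epsilon>>0. \<exists>n0. \<forall>m\<ge>n0. \<forall>n\<ge>n0. L2_dist P (f (r m)) (f (r n)) < \<epsilon>"
proof -
  interpret N: prob_space N using bb by (simp add: brownian_bridge_def)
  interpret L: Metric_space "mspace (linfty F)" "mdist (linfty F)"
    by (rule Metric_space_mspace_mdist)
  obtain K where K: "compactin (mtopology_of (linfty F)) K"
    and half: "measure N {\<omega>\<in>space N. G \<omega> \<in> K} \<ge> 1 / 2"
  proof -
    have "tight_rv (linfty F) N G"
      using bb by (simp add: brownian_bridge_def)
    then have "\<exists>K. compactin (mtopology_of (linfty F)) K \<and> measure N {\<omega>\<in>space N. G \<omega> \<in> K} \<ge> 1 - 1 / 2"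
      unfolding tight_rv_def by (elim allE[of _ "1 / 2"]) auto
    with that show ?thesis by auto
  qed
  have "L.mtotally_bounded K"
    using K by (intro L.compactin_imp_mtotally_bounded) (simp add: mtopology_of_def)
  \<comment> \<open>The finite nets of mesh \<open>1 / Suc i\<close> have a countable union
    \<open>S\<close> that is dense in \<open>K\<close>.\<close>
  then have "\<forall>i. \<exists>A. finite A \<and> A \<subseteq> K \<and> K \<subseteq> (\<Union>u\<in>A. L.mball u (1 / Suc i))"
    unfolding L.mtotally_bounded_def by (metis zero_less_divide_1_iff of_nat_0_less_iff zero_less_Suc)
  then obtain A where A: "\<And>i. finite (A i)" "\<And>i. A i \<subseteq> K" "\<And>i. K \<subseteq> (\<Union>u\<in>A i. L.mball u (1 / Suc i))"
    by metis
  define S where "S = (\<Union>i. A i)"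
  have KL: "K \<subseteq> mspace (linfty F)"
    using compactin_subset_topspace[OF K] by simp
  then have SL: "S \<subseteq> mspace (linfty F)"
    using A(2) by (auto simp: S_def)
  have "\<forall>u\<in>S. \<exists>B>0. \<forall>f\<in>F. \<bar>u f\<bar> \<le> B"
    using SL linfty_bounded by (metis subset_iff)
  then obtain B where B: "\<And>u. u \<in> S \<Longrightarrow> B u > 0" "\<And>u f. u \<in> S \<Longrightarrow> f \<in> F \<Longrightarrow> \<bar>u f\<bar> \<le> B u"
    by metis
  \<comment> \<open>The diagonal argument needs one bound for all functionals, so each
    \<open>u\<close> is divided by its own bound \<open>B u\<close>; the scaling is undone
    below.\<close>
  obtain r :: "nat \<Rightarrow> nat" where r: "strict_mono r"
    and lim: "\<And>u. u \<in> S \<Longrightarrow> \<exists>l. (\<lambda>n. u (f (r n)) / B u) \<longlonglongrightarrow> l"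
  proof (rule function_convergent_subsequence[of S "\<lambda>n u. u (f n) / B u" 1])
    show "countable S"
      unfolding S_def using A(1) by (auto intro: countable_finite)
    show "norm (u (f n) / B u) \<le> 1" if "u \<in> S" for n u
      using B[OF that] f by simp
  qed auto
  have cauchy_u: "Cauchy (\<lambda>n. u (f (r n)))" if "u \<in> S" for u
  proof -
    obtain l where "(\<lambda>n. u (f (r n)) / B u) \<longlonglongrightarrow> l"
      using lim \<open>u \<in> S\<close> by blast
    then have "(\<lambda>n. u (f (r n)) / B u * B u) \<longlonglongrightarrow> l * B u"
      by (intro tendsto_mult tendsto_const)
    then show ?thesis
      using B(1)[OF \<open>u \<in> S\<close>] by (intro LIMSEQ_imp_Cauchy) simp
  qed
  have "Cauchy (\<lambda>n. \<integral>z. f (r n) z \<partial>P)"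
    using convergent_subseq_convergent[OF conv r] by (simp add: o_def Cauchy_convergent_iff)
  have "\<exists>n0. \<forall>m\<ge>n0. \<forall>n\<ge>n0. L2_dist P (f (r m)) (f (r n)) < \<epsilon>" if \<epsilon>: "\<epsilon> > 0" for \<epsilon>
  proof -
    \<comment> \<open>The constant 12: paths in \<open>K\<close> oscillate by at most 3 \<eta>, the
      small-ball bound doubles this to 6 \<eta>, and the result has to be below \<epsilon> /
      2.\<close>
    obtain i where i: "1 / Suc i < \<epsilon> / 12"
      using \<epsilon> by (metis nat_approx_posE zero_less_divide_iff zero_less_numeral)
    define \<eta> where "\<eta> = 1 / Suc i"
    have \<eta>: "\<eta> > 0" by (simp add: \<eta>_def)
    have "\<forall>u\<in>A i. \<exists>n0. \<forall>m\<ge>n0. \<forall>n\<ge>n0. \<bar>u (f (r m)) - u (f (r n))\<bar> < \<eta>"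
      using cauchy_u \<eta> unfolding S_def Cauchy_def dist_real_def by blast
    then obtain M where M: "\<And>u m n. u \<in> A i \<Longrightarrow> m \<ge> M u \<Longrightarrow> n \<ge> M u \<Longrightarrow> \<bar>u (f (r m)) - u (f (r n))\<bar> < \<eta>"
      by metis
    obtain n1 where n1: "\<And>m n. m \<ge> n1 \<Longrightarrow> n \<ge> n1 \<Longrightarrow> \<bar>(\<integral>z. f (r m) z \<partial>P) - (\<integral>z. f (r n) z \<partial>P)\<bar> < \<epsilon> / 2"
      using \<open>Cauchy (\<lambda>n. \<integral>z. f (r n) z \<partial>P)\<close> \<epsilon> unfolding Cauchy_def dist_real_def
      by (meson half_gt_zero)
    \<comment> \<open>The net is finite, so the sum of the thresholds dominates each of
      them.\<close>
    define n0 where "n0 = n1 + (\<Sum>u\<in>A i. M u)"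
    have n0: "n1 \<le> n0" "\<And>u. u \<in> A i \<Longrightarrow> M u \<le> n0"
      using member_le_sum[of _ "A i" M] A(1) by (auto simp: n0_def intro: trans_le_add2)
    have "L2_dist P (f (r m)) (f (r n)) < \<epsilon>" if mn: "m \<ge> n0" "n \<ge> n0" for m n
    proof -
      have osc: "\<bar>v (f (r m)) - v (f (r n))\<bar> \<le> 3 * \<eta>" if v: "v \<in> K" for v
      proof -
        \<comment> \<open>A net point \<open>u\<close> within \<eta> of \<open>v\<close> costs
          \<eta> at each of the two functions, and \<open>u\<close> itself oscillates by less than
          \<eta>.\<close>
        obtain u where u: "u \<in> A i" "v \<in> L.mball u \<eta>"
          using A(3)[of i] v unfolding \<eta>_def by blast
        have "\<bar>u (f k) - v (f k)\<bar> < \<eta>" for k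
        proof -
          have "\<bar>u (f k) - v (f k)\<bar> \<le> mdist (linfty F) u v"
            using u(2) by (intro linfty_abs_diff_le f) (simp_all only: L.in_mball)
          also have "\<dots> < \<eta>"
            using u(2) by (simp only: L.in_mball)
          finally show ?thesis .
        qed
        from this[of "r m"] this[of "r n"] M[OF u(1), of m n] n0(2)[OF u(1)] mn show ?thesis
          by linarith
      qed
      let ?D = "\<lambda>\<omega>. G \<omega> (f (r m)) - G \<omega> (f (r n))"
      have D: "normal_rv N ?D 0"
        using f by (intro brownian_bridge_diff_normal[OF bb])
      then have [measurable]: "?D \<in> borel_measurable N"
        by (simp add: normal_rv_def)
      have "measure N {\<omega>\<in>space N. G \<omega> \<in> K} \<le> measure N {\<omega>\<in>space N. \<bar>?D \<omega>\<bar> \<le> 3 * \<eta>}"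
        using osc by (intro N.finite_measure_mono) auto
      with half have "(\<integral>\<omega>. (?D \<omega>)\<^sup>2 \<partial>N) \<le> (2 * (3 * \<eta>))\<^sup>2"
        by (intro normal_rv_small_ball[OF N.prob_space_axioms D]) linarith
      also have "\<dots> < (\<epsilon> / 2)\<^sup>2"
        using i \<eta> unfolding \<eta>_def by (intro power_strict_mono) auto
      finally have "(\<integral>\<omega>. (?D \<omega>)\<^sup>2 \<partial>N) < (\<epsilon> / 2)\<^sup>2" .
      moreover have "((\<integral>z. f (r m) z \<partial>P) - (\<integral>z. f (r n) z \<partial>P))\<^sup>2 < (\<epsilon> / 2)\<^sup>2"
        using n1[of m n] n0(1) mn by (subst power2_abs[symmetric]) (intro power_strict_mono, auto)
      ultimately have "(L2_dist P (f (r m)) (f (r n)))\<^sup>2 < (\<epsilon> / 2)\<^sup>2 + (\<epsilon> / 2)\<^sup>2"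
        using brownian_bridge_diff_variance[OF P bb f f, of "r m" "r n"] by linarith
      also have "\<dots> \<le> \<epsilon>\<^sup>2"
        by (simp add: power_divide)
      finally show ?thesis
        by (rule power2_less_imp_less) (use \<epsilon> in simp)
    qed
    then show ?thesis by blast
  qed
  with r that show ?thesis by blast
qed

section \<open>The bridge extended to the completion\<close>

lemma brownian_bridge_extension_normal:
  assumes P: "prob_space P" and bb: "brownian_bridge P F N G"
    and uc: "\<And>\<omega>. \<omega> \<in> space N \<Longrightarrow> L2_uniformly_continuous P F (G \<omega>)"
    and q: "q \<in> L2_completion P F"
  shows "normal_rv N (\<lambda>\<omega>. extend_cont P F (G \<omega>) q) 0"
proof -
  have F: "F \<subseteq> L2_funs P" and N: "prob_space N"
    using bb by (auto simp: brownian_bridge_def)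
  obtain g f where g: "g \<in> L2_funs P" "q = ae_eq_rel P `` {g}"
    and f0: "\<forall>n. f n \<in> F" "(\<lambda>n. L2_dist P (f n) g) \<longlonglongrightarrow> 0"
    using q by (elim L2_completionE)
  note f = f0(1)[rule_format] f0(2)
  have Y: "normal_rv N (\<lambda>\<omega>. G \<omega> (f n)) 0" for n
    using bb f(1) by (rule brownian_bridge_normal)
  have lim: "(\<lambda>n. G \<omega> (f n)) \<longlonglongrightarrow> extend_cont P F (G \<omega>) q" if "\<omega> \<in> space N" for \<omega>
    unfolding g(2) using P F uc[OF that] g(1) f by (rule extend_cont_tendsto)
  \<comment> \<open>Second moments are squared distances to the zero function, so continuity of the
    L^2 distance gives their convergence.\<close>
  have 0: "(\<lambda>_. 0) \<in> L2_funs P" by (simp add: L2_funs_def)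
  have "(\<lambda>n. L2_dist P (f n) (\<lambda>_. 0)) \<longlonglongrightarrow> L2_dist P g (\<lambda>_. 0)"
    using f(1) F by (intro L2_dist_tendsto g(1) f(2) 0) (auto simp: L2_dist_def)
  moreover have "(\<lambda>n. \<integral>z. f n z \<partial>P) \<longlonglongrightarrow> extend_cont P F (\<lambda>f. \<integral>z. f z \<partial>P) q"
    unfolding g(2) using P F L2_uniformly_continuous_integral[OF P F] g(1) f by (rule extend_cont_tendsto)
  ultimately have "(\<lambda>n. (L2_dist P (f n) (\<lambda>_. 0))\<^sup>2 - (\<integral>z. f n z \<partial>P)\<^sup>2) \<longlonglongrightarrow>
      (L2_dist P g (\<lambda>_. 0))\<^sup>2 - (extend_cont P F (\<lambda>f. \<integral>z. f z \<partial>P) q)\<^sup>2"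
    by (intro tendsto_intros)
  then have v: "(\<lambda>n. \<integral>\<omega>. (G \<omega> (f n))\<^sup>2 \<partial>N) \<longlonglongrightarrow>
      (L2_dist P g (\<lambda>_. 0))\<^sup>2 - (extend_cont P F (\<lambda>f. \<integral>z. f z \<partial>P) q)\<^sup>2"
    by (simp add: L2_dist_squared brownian_bridge_variance[OF bb f(1)])
  have m: "(\<lambda>\<omega>. extend_cont P F (G \<omega>) q) \<in> borel_measurable N"
    using Y by (intro borel_measurable_LIMSEQ_real[OF lim]) (auto simp: normal_rv_def)
  show ?thesis
    using lim by (intro normal_rv_AE_limit(1)[OF N Y m _ v]) auto
qed

text \<open>The increments along approximating sequences tend to 0 almost everywhere, so the limit
  of their variances is 0. That limit is the squared L^2 distance of the representatives, because
  the equal means remove the correction term.\<close>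

lemma brownian_bridge_extension_AE_eq_imp_eq:
  assumes P: "prob_space P" and bb: "brownian_bridge P F N G"
    and uc: "\<And>\<omega>. \<omega> \<in> space N \<Longrightarrow> L2_uniformly_continuous P F (G \<omega>)"
    and q: "q \<in> L2_completion P F" "q' \<in> L2_completion P F"
    and mean: "extend_cont P F (\<lambda>f. \<integral>z. f z \<partial>P) q = extend_cont P F (\<lambda>f. \<integral>z. f z \<partial>P) q'"
    and eq: "AE \<omega> in N. extend_cont P F (G \<omega>) q = extend_cont P F (G \<omega>) q'"
  shows "q = q'"
proof -
  have F: "F \<subseteq> L2_funs P" and N: "prob_space N"
    using bb by (auto simp: brownian_bridge_def)
  obtain g f where g: "g \<in> L2_funs P" "q = ae_eq_rel P `` {g}"
    and f0: "\<forall>n. f n \<in> F" "(\<lambda>n. L2_dist P (f n) g) \<longlonglongrightarrow> 0"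
    using q(1) by (elim L2_completionE)
  note f = f0(1)[rule_format] f0(2)
  obtain g' f' where g': "g' \<in> L2_funs P" "q' = ae_eq_rel P `` {g'}"
    and f'0: "\<forall>n. f' n \<in> F" "(\<lambda>n. L2_dist P (f' n) g') \<longlonglongrightarrow> 0"
    using q(2) by (elim L2_completionE)
  note f' = f'0(1)[rule_format] f'0(2)
  have lim: "(\<lambda>n. u (f n)) \<longlonglongrightarrow> extend_cont P F u q" "(\<lambda>n. u (f' n)) \<longlonglongrightarrow> extend_cont P F u q'"
    if "L2_uniformly_continuous P F u" for u
    unfolding g(2) g'(2)
    by (rule extend_cont_tendsto[OF P F that g(1) f] extend_cont_tendsto[OF P F that g'(1) f'])+
  let ?D = "\<lambda>n \<omega>. G \<omega> (f n) - G \<omega> (f' n)"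
  have D: "normal_rv N (?D n) 0" for n
    using bb f(1) f'(1) by (rule brownian_bridge_diff_normal)
  have "AE \<omega> in N. (\<lambda>n. ?D n \<omega>) \<longlonglongrightarrow> 0"
    using eq AE_space
  proof eventually_elim
    case (elim \<omega>)
    show ?case
      using tendsto_diff[OF lim(1)[OF uc[OF elim(2)]] lim(2)[OF uc[OF elim(2)]]] elim(1) by simp
  qed
  moreover have "(\<lambda>n. \<integral>\<omega>. (?D n \<omega>)\<^sup>2 \<partial>N) \<longlonglongrightarrow> (L2_dist P g g')\<^sup>2"
  proof -
    have "(\<lambda>n. L2_dist P (f n) (f' n)) \<longlonglongrightarrow> L2_dist P g g'"
      using f(1) f'(1) F by (intro L2_dist_tendsto g(1) g'(1) f(2) f'(2)) blast+
    moreover have "(\<lambda>n. (\<integral>z. f n z \<partial>P) - (\<integral>z. f' n z \<partial>P)) \<longlonglongrightarrow> 0"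
      using tendsto_diff[OF lim[OF L2_uniformly_continuous_integral[OF P F]]] mean by simp
    ultimately have "(\<lambda>n. (L2_dist P (f n) (f' n))\<^sup>2 - ((\<integral>z. f n z \<partial>P) - (\<integral>z. f' n z \<partial>P))\<^sup>2)
        \<longlonglongrightarrow> (L2_dist P g g')\<^sup>2 - 0\<^sup>2"
      by (intro tendsto_intros)
    then show ?thesis
      by (simp add: brownian_bridge_diff_variance[OF P bb f(1) f'(1)])
  qed
  ultimately have "(\<integral>\<omega>. 0\<^sup>2 \<partial>N) = (L2_dist P g g')\<^sup>2"
    by (intro normal_rv_AE_limit(2)[OF N D, of "\<lambda>_. 0"]) auto
  then have "L2_dist P g g' = 0" by simp
  then have "AE z in P. g z = g' z"
    using g(1) g'(1) by (intro L2_dist_eq_0_imp_AE)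
  then show ?thesis
    unfolding g(2) g'(2) using g(1) g'(1) by (rule ae_eq_rel_Image_eqI)
qed

text \<open>A minimising sequence has convergent means, which is what the compactness argument asks
  for; its Cauchy subsequence has an L^2 limit whose class attains the infimum.\<close>

lemma brownian_bridge_argmin_nonempty:
  assumes P: "prob_space P" and bb: "brownian_bridge P F N G" and "F \<noteq> {}"
    and bdd: "bdd_below ((\<lambda>f. \<integral>z. f z \<partial>P) ` F)"
  obtains q where "q \<in> L2_completion P F"
    "extend_cont P F (\<lambda>f. \<integral>z. f z \<partial>P) q = (INF f\<in>F. \<integral>z. f z \<partial>P)"
proof -
  define W where "W = (INF f\<in>F. \<integral>z. f z \<partial>P)"
  have F: "F \<subseteq> L2_funs P"
    using bb by (auto simp: brownian_bridge_def)
  have "\<exists>f\<in>F. (\<integral>z. f z \<partial>P) < W + inverse (Suc n)" for n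
    using cINF_less_iff[OF \<open>F \<noteq> {}\<close> bdd, of "W + inverse (Suc n)"] by (simp add: W_def del: of_nat_Suc)
  then obtain f where f: "\<And>n. f n \<in> F" "\<And>n. (\<integral>z. f n z \<partial>P) < W + inverse (Suc n)"
    by metis
  have lim: "(\<lambda>n. \<integral>z. f n z \<partial>P) \<longlonglongrightarrow> W"
  proof (rule tendsto_sandwich[OF _ _ tendsto_const])
    show "(\<lambda>n. W + inverse (Suc n)) \<longlonglongrightarrow> W"
      using tendsto_add[OF tendsto_const LIMSEQ_inverse_real_of_nat, of W] by simp
    show "\<forall>\<^sub>F n in sequentially. W \<le> (\<integral>z. f n z \<partial>P)"
      unfolding W_def using f(1) by (auto intro!: always_eventually cINF_lower[OF bdd])
    show "\<forall>\<^sub>F n in sequentially. (\<integral>z. f n z \<partial>P) \<le> W + inverse (Suc n)"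
      by (intro always_eventually allI less_imp_le f(2))
  qed
  obtain r :: "nat \<Rightarrow> nat" where r: "strict_mono r"
    "\<forall>\<epsilon>>0. \<exists>n0. \<forall>m\<ge>n0. \<forall>n\<ge>n0. L2_dist P (f (r m)) (f (r n)) < \<epsilon>"
    by (rule brownian_bridge_Cauchy_subsequence[OF P bb f(1) convergentI[OF lim]])
  have "f (r n) \<in> L2_funs P" for n
    using f(1) F by auto
  from L2_complete[OF P this r(2)[rule_format]]
  obtain g where g: "g \<in> L2_funs P" "(\<lambda>n. L2_dist P (f (r n)) g) \<longlonglongrightarrow> 0"
    by blast
  show ?thesis
  proof (rule that)
    show "ae_eq_rel P `` {g} \<in> L2_completion P F"
      using g(1) f(1) g(2) by (rule in_L2_completionI)
    have "(\<lambda>n. \<integral>z. f (r n) z \<partial>P) \<longlonglongrightarrow> extend_cont P F (\<lambda>f. \<integral>z. f z \<partial>P) (ae_eq_rel P `` {g})"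
      by (rule extend_cont_tendsto[OF P F L2_uniformly_continuous_integral[OF P F] g(1) f(1) g(2)])
    moreover have "(\<lambda>n. \<integral>z. f (r n) z \<partial>P) \<longlonglongrightarrow> W"
      using LIMSEQ_subseq_LIMSEQ[OF lim r(1)] by (simp add: o_def)
    ultimately show "extend_cont P F (\<lambda>f. \<integral>z. f z \<partial>P) (ae_eq_rel P `` {g}) = (INF f\<in>F. \<integral>z. f z \<partial>P)"
      unfolding W_def[symmetric] by (rule LIMSEQ_unique)
  qed
qed

section \<open>Comparing the infimum with the value at one point\<close>

lemma normal_rv_0_imp_zero_mean:
  assumes "prob_space N" "normal_rv N Y 0"
  shows "zero_mean N Y"
  using normal_rv_expectation[OF assms] by (simp add: zero_mean_def)

lemma zero_mean_le_imp_AE_eq: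
  assumes "zero_mean N Y" "zero_mean N Z" "\<And>\<omega>. \<omega> \<in> space N \<Longrightarrow> Y \<omega> \<le> Z \<omega>"
  shows "AE \<omega> in N. Y \<omega> = Z \<omega>"
proof -
  have "integrable N (\<lambda>\<omega>. Z \<omega> - Y \<omega>)" "(\<integral>\<omega>. Z \<omega> - Y \<omega> \<partial>N) = 0"
    using assms(1,2) by (auto simp: zero_mean_def)
  moreover have "AE \<omega> in N. 0 \<le> Z \<omega> - Y \<omega>"
    using assms(3) by auto
  ultimately have "AE \<omega> in N. Z \<omega> - Y \<omega> = 0"
    using integral_nonneg_eq_0_iff_AE by blast
  then show ?thesis by auto
qed

text \<open>A real infimum is a lower bound only for a set bounded below. Each path is bounded on
  \<open>F\<close>, and the bound survives the limits that define the extension.\<close>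

lemma brownian_bridge_extension_INF_le:
  assumes P: "prob_space P" and bb: "brownian_bridge P F N G"
    and uc: "L2_uniformly_continuous P F (G \<omega>)" and \<omega>: "\<omega> \<in> space N"
    and S: "S \<subseteq> L2_completion P F" "q \<in> S"
  shows "(INF q\<in>S. extend_cont P F (G \<omega>) q) \<le> extend_cont P F (G \<omega>) q"
proof (rule cINF_lower[OF _ S(2)])
  obtain B where B: "\<And>f. f \<in> F \<Longrightarrow> \<bar>G \<omega> f\<bar> \<le> B"
    using brownian_bridge_in_linfty[OF bb \<omega>] linfty_bounded by metis
  show "bdd_below (extend_cont P F (G \<omega>) ` S)"
  proof (rule bdd_belowI2)
    fix q assume "q \<in> S"
    with S(1) have "q \<in> L2_completion P F" by blast
    then obtain g f where g: "g \<in> L2_funs P" "q = ae_eq_rel P `` {g}"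
      and f0: "\<forall>n. f n \<in> F" "(\<lambda>n. L2_dist P (f n) g) \<longlonglongrightarrow> 0"
      by (elim L2_completionE)
    note f = f0(1)[rule_format] f0(2)
    have "F \<subseteq> L2_funs P"
      using bb by (simp add: brownian_bridge_def)
    then have "(\<lambda>n. G \<omega> (f n)) \<longlonglongrightarrow> extend_cont P F (G \<omega>) q"
      unfolding g(2) using P uc g(1) f by (intro extend_cont_tendsto)
    moreover have "- B \<le> G \<omega> (f n)" for n
      using B[OF f(1)[of n]] by linarith
    ultimately show "- B \<le> extend_cont P F (G \<omega>) q"
      by (intro LIMSEQ_le_const) auto
  qed
qed

section \<open>The \<open>k\<close>-means class\<close>

text \<open>The disjunction expresses that \<open>C\<close> has at least \<open>k\<close> points, as
  \<open>card\<close> is 0 on infinite sets.\<close>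

lemma kmeans_class_nonempty:
  assumes "infinite C \<or> card C \<ge> k"
  shows "kmeans_class k C \<noteq> {}"
proof -
  obtain D where "D \<subseteq> C" "finite D" "card D = k"
    using assms infinite_arbitrarily_large[of C k] obtain_subset_with_card_n[of k C] by blast
  then obtain a where "set a = D" "distinct a" "length a = k"
    using finite_distinct_list distinct_card by metis
  with \<open>D \<subseteq> C\<close> have "a \<in> distinct_tuples k C"
    by (simp add: distinct_tuples_def)
  then show ?thesis by (auto simp: kmeans_class_def)
qed

text \<open>A positive \<open>k\<close> makes the minimum range over a nonempty set of squares. The
  resulting lower bound 0 for the means makes their infimum meaningful.\<close>

lemma kmeans_class_nonneg:
  assumes "k \<ge> 1" "f \<in> kmeans_class k C"
  shows "0 \<le> f z"
proof -
  obtain a where a: "length a = k" "f = kmeans_fun a"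
    using assms(2) by (auto simp: kmeans_class_def distinct_tuples_def)
  with assms(1) have "set a \<noteq> {}" by auto
  then show ?thesis
    by (simp add: a(2) kmeans_fun_def)
qed

theorem corollary2:
  fixes M :: "'a measure"
    and X :: "'a \<Rightarrow> 'b::{banach, second_countable_topology}"
    and P :: "'b measure"
    and k :: nat
    and C :: "'b set"
    and N :: "'w measure"
    and G :: "'w \<Rightarrow> ('b \<Rightarrow> real) \<Rightarrow> real"
    and T :: "'w \<Rightarrow> real"
  assumes "prob_space M"
    and "X \<in> borel_measurable M"
    and "P = distr M borel X"
    and "k \<ge> 1"
    and "infinite C \<or> card C \<ge> k"
    and "integrable M (\<lambda>\<omega>. (norm (X \<omega>))\<^sup>2)"
    and "bounded C"
    and "donsker P (kmeans_class k C)"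
    and "brownian_bridge P (kmeans_class k C) N G"
    and "\<forall>\<omega>\<in>space N. L2_uniformly_continuous P (kmeans_class k C) (G \<omega>)"
    and "T = (\<lambda>\<omega>. kmeans_limit P k C (G \<omega>))"
  shows "(kmeans_unique P k C \<longleftrightarrow> normal_rv N T 0) \<and>
         (normal_rv N T 0 \<longleftrightarrow> zero_mean N T)"
proof -
  let ?F = "kmeans_class k C"
  let ?S = "kmeans_argmin P k C"
  have P: "prob_space P"
    using assms(1-3) by (simp add: prob_space.prob_space_distr)
  note bb = assms(9)
  have uc: "L2_uniformly_continuous P ?F (G \<omega>)" if "\<omega> \<in> space N" for \<omega>
    using assms(10) that by blast
  have N: "prob_space N"
    using bb by (simp add: brownian_bridge_def)
  have T: "T \<omega> = (INF q\<in>?S. extend_cont P ?F (G \<omega>) q)" for \<omega>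
    by (simp add: assms(11) kmeans_limit_def)
  have S: "?S \<subseteq> L2_completion P ?F"
    by (auto simp: kmeans_argmin_def)
  have normal: "normal_rv N (\<lambda>\<omega>. extend_cont P ?F (G \<omega>) q) 0" if "q \<in> ?S" for q
    using brownian_bridge_extension_normal[OF P bb uc] S that by blast
  \<comment> \<open>The equivalences are proved as a cycle. Over a single minimiser the infimum is
    the value of the extended process there.\<close>
  have "normal_rv N T 0" if "kmeans_unique P k C"
  proof -
    obtain q where "?S = {q}"
      using \<open>kmeans_unique P k C\<close> by (auto simp: kmeans_unique_def card_1_singleton_iff)
    then have "T = (\<lambda>\<omega>. extend_cont P ?F (G \<omega>) q)" "q \<in> ?S"
      using T by auto
    with normal show ?thesis by simp
  qed
  moreover have "zero_mean N T" if "normal_rv N T 0"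
    using N that by (rule normal_rv_0_imp_zero_mean)
  moreover have "kmeans_unique P k C" if zm: "zero_mean N T"
  proof -
    have "bdd_below ((\<lambda>f. \<integral>z. f z \<partial>P) ` ?F)"
      using kmeans_class_nonneg[OF \<open>k \<ge> 1\<close>]
      by (intro bdd_belowI2[of _ 0] Bochner_Integration.integral_nonneg)
    \<comment> \<open>Uniqueness includes existence, so a minimiser has to be produced before any
      two are compared.\<close>
    then obtain q where q: "q \<in> ?S"
      using brownian_bridge_argmin_nonempty[OF P bb kmeans_class_nonempty[OF assms(5)]]
      by (auto simp: kmeans_argmin_def kmeans_opt_def)
    \<comment> \<open>\<open>T\<close> lies below the process at \<open>p\<close> and both have mean
      zero, so their nonnegative difference vanishes almost surely.\<close>
    have AE_T: "AE \<omega> in N. T \<omega> = extend_cont P ?F (G \<omega>) p" if p: "p \<in> ?S" for p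
      using zm normal_rv_0_imp_zero_mean[OF N normal[OF p]]
    proof (rule zero_mean_le_imp_AE_eq)
      show "T \<omega> \<le> extend_cont P ?F (G \<omega>) p" if "\<omega> \<in> space N" for \<omega>
        unfolding T using P bb uc[OF that] that S p by (rule brownian_bridge_extension_INF_le)
    qed
    have "p = q" if p: "p \<in> ?S" for p
    proof (rule brownian_bridge_extension_AE_eq_imp_eq[OF P bb uc])
      show "AE \<omega> in N. extend_cont P ?F (G \<omega>) p = extend_cont P ?F (G \<omega>) q"
        using AE_T[OF p] AE_T[OF q] by eventually_elim simp
    qed (use p q in \<open>auto simp: kmeans_argmin_def\<close>)
    with q have "?S = {q}" by blast
    then show ?thesis by (simp add: kmeans_unique_def)
  qed
  ultimately show ?thesis by blast
qed

end
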